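(* Let $q$ be a prime power and $0<a<1$. Choose a non-negative integer $n$ with probability $(1-a)a^n$, and then choose $g$ uniformly at random from the unitary group $U(n,q)\subseteq GL(n,q^2)$ acting naturally on $\mathbb{F}_{q^2}^n$ (with $U(0,q)$ trivial). Then for every integer $k\ge0$, the probability that $g$ has exactly $q^{2k}$ fixed vectors equals $$w_{AC}(p^{-k};-a;p)=(-ap;p)_\infty\frac{p^{k^2}(-a)^k}{(p;p)_k(-ap;p)_k},\qquad p=-1/q.$$
   Context: For complex $A$, $B$ and integer $m\ge0$, $(A;B)_m=(1-A)(1-AB)\cdots(1-AB^{m-1})$ (with $(A;B)_0=1$), and for $|B|<1$, $(A;B)_\infty=\prod_{r\ge0}(1-AB^r)$. In general $w_{AC}(p^{-k};b;p)=(bp;p)_\infty\frac{p^{k^2}b^k}{(p;p)_k(bp;p)_k}$ is the Al-Salam–Carlitz weight. $U(n,q)$ is the group of elements of $GL(n,q^2)$ preserving a nondegenerate Hermitian form. *)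

theory Defs
  imports
    "HOL-Probability.Probability"
    "HOL-Number_Theory.Prime_Powers"
    "Jordan_Normal_Form.Matrix"
begin

definition qpoch :: "'a::comm_ring_1 \<Rightarrow> 'a \<Rightarrow> nat \<Rightarrow> 'a" where
  "qpoch A B m = (\<Prod>i<m. 1 - A * B ^ i)"

text \<open>Only meaningful for \<open>norm B < 1\<close>, where the product converges.\<close>
definition qpoch_inf :: "'a::real_normed_field \<Rightarrow> 'a \<Rightarrow> 'a" where
  "qpoch_inf A B = prodinf (\<lambda>r. 1 - A * B ^ r)"

text \<open>\<open>w_AC k b p\<close> is the Al-Salam--Carlitz weight at the mass point \<open>p\<close> to the power \<open>- k\<close>.\<close>
definition w_AC :: "nat \<Rightarrow> 'a::real_normed_field \<Rightarrow> 'a \<Rightarrow> 'a" where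
  "w_AC k b p =
     qpoch_inf (b * p) p * (p ^ k\<^sup>2 * b ^ k / (qpoch p p k * qpoch (b * p) p k))"

text \<open>
  The field is any type with \<open>q\<^sup>2\<close> elements; its involutory automorphism is \<open>x \<mapsto> x ^ q\<close>.
  Forms are linear in the first argument; only their values on vectors of length \<open>n\<close> matter.
\<close>
definition nondegenerate_hermitian_form ::
    "nat \<Rightarrow> nat \<Rightarrow> ('a::field vec \<Rightarrow> 'a vec \<Rightarrow> 'a) \<Rightarrow> bool" where
  "nondegenerate_hermitian_form q n h \<longleftrightarrow>
     (\<forall>u \<in> carrier_vec n. \<forall>v \<in> carrier_vec n. \<forall>w \<in> carrier_vec n. h (u + v) w = h u w + h v w) \<and>
     (\<forall>c. \<forall>u \<in> carrier_vec n. \<forall>w \<in> carrier_vec n. h (c \<cdot>\<^sub>v u) w = c * h u w) \<and>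
     (\<forall>u \<in> carrier_vec n. \<forall>w \<in> carrier_vec n. h w u = h u w ^ q) \<and>
     (\<forall>u \<in> carrier_vec n. (\<forall>w \<in> carrier_vec n. h u w = 0) \<longrightarrow> u = 0\<^sub>v n)"

definition unitary_group ::
    "nat \<Rightarrow> ('a::field vec \<Rightarrow> 'a vec \<Rightarrow> 'a) \<Rightarrow> 'a mat set" where
  "unitary_group n h =
     {g \<in> carrier_mat n n. invertible_mat g \<and>
        (\<forall>u \<in> carrier_vec n. \<forall>v \<in> carrier_vec n. h (g *\<^sub>v u) (g *\<^sub>v v) = h u v)}"

definition fixed_vectors :: "'a::semiring_0 mat \<Rightarrow> 'a vec set" where
  "fixed_vectors g = {v \<in> carrier_vec (dim_row g). g *\<^sub>v v = v}"

text \<open>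
  The library's \<open>geometric_pmf (1 - a)\<close> gives \<open>n\<close> the mass \<open>(1 - a) * a ^ n\<close>.
  The family \<open>h\<close> supplies the Hermitian form used in each dimension.
\<close>
definition random_unitary ::
    "real \<Rightarrow> (nat \<Rightarrow> 'a::{field,finite} vec \<Rightarrow> 'a vec \<Rightarrow> 'a) \<Rightarrow> 'a mat pmf" where
  "random_unitary a h =
     bind_pmf (geometric_pmf (1 - a)) (\<lambda>n. pmf_of_set (unitary_group n (h n)))"

text \<open>The set passed to \<open>pmf_of_set\<close> is always finite and nonempty.\<close>
lemma finite_unitary_group: "finite (unitary_group n (h :: 'a::{field,finite} vec \<Rightarrow> _))"
proof -
  have "carrier_mat n n \<subseteq> (\<lambda>f. mat n n f) ` (({..<n} \<times> {..<n}) \<rightarrow>\<^sub>E (UNIV :: 'a set))"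
  proof
    fix A :: "'a mat" assume A: "A \<in> carrier_mat n n"
    have "A = mat n n (restrict (\<lambda>ij. A $$ ij) ({..<n} \<times> {..<n}))"
      by (rule eq_matI) (use A in auto)
    moreover have "restrict (\<lambda>ij. A $$ ij) ({..<n} \<times> {..<n}) \<in> ({..<n} \<times> {..<n}) \<rightarrow>\<^sub>E UNIV"
      by simp
    ultimately show "A \<in> (\<lambda>f. mat n n f) ` (({..<n} \<times> {..<n}) \<rightarrow>\<^sub>E UNIV)"
      by (metis imageI)
  qed
  then have "finite (carrier_mat n n :: 'a mat set)"
    by (rule finite_subset) (intro finite_imageI finite_PiE, auto)
  then show ?thesis
    by (rule rev_finite_subset) (auto simp: unitary_group_def)
qed

lemma one_in_unitary_group: "1\<^sub>m n \<in> unitary_group n h"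
  unfolding unitary_group_def invertible_mat_def inverts_mat_def
  by (auto intro!: exI[of _ "1\<^sub>m n"])

end

theory Submission
  imports
    Defs
    "HOL-Library.Function_Algebras"
    "HOL-Number_Theory.Residues"
    "Jordan_Normal_Form.Determinant"
begin

text \<open>
  Put \<open>b = - q\<close>, \<open>Q = q\<^sup>2\<close> and \<open>y = b ^ k\<close> when \<open>g\<close> has \<open>Q ^ k\<close> fixed vectors. By Burnside's lemma the mean
  over \<open>U(n,q)\<close> of \<open>(y\<^sup>2 - Q\<^sup>0) \<dots> (y\<^sup>2 - Q ^ (d - 1))\<close> is the number of orbits on linearly independent
  \<open>d\<close>-tuples. By Witt's theorem these orbits are the Hermitian \<open>d \<times> d\<close> Gram matrices of corank at most
  \<open>n - d\<close>, which can be counted by adding one vector at a time and keeping track of the radical of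
  the span. Re-expanding in the Newton basis \<open>\<phi>\<^sub>j = (y - 1)(y - b) \<dots> (y - b ^ (j - 1))\<close> shows that the mean
  of \<open>\<phi>\<^sub>j\<close> is simply \<open>(- 1) ^ j\<close> for \<open>j \<le> n\<close>, and \<open>0\<close> for \<open>j > n\<close>. The indicator of a value of \<open>k\<close> is a
  combination of the \<open>\<phi>\<^sub>j\<close>, which gives the law of \<open>k\<close> for fixed \<open>n\<close>; the geometric mixture over \<open>n\<close> is then
  summed by Euler's expansion of \<open>(- x;p)\<^sub>\<infinity>\<close> in powers of \<open>x\<close>.
\<close>

section \<open>Finite fields of square order\<close>

text \<open>The sign of \<open>b\<close> reflects the duality q -> -q between U(n,q) and GL(n,q).
  GL(n,q) is transitive on independent j-tuples, so there the mean of (q^k - 1)(q^k - q) ... (q^k -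
  q^(j-1)) is 1 for j <= n. For U(n,q) the analogue \<open>newton b j (b ^ k)\<close> counts nothing
  and can be negative: orbit counting reaches only polynomials in y^2. The product of the y^2 - Q^i,
  i < d, expands into \<open>newton b (d + s)\<close> with s <= d, and the coefficient is, up to
  sign, the number of Hermitian d x d matrices of corank s. The bound s <= n - d on the corank is
  the bound d + s <= n beyond which the Newton polynomial vanishes at every y = b^k with k <= n. So
  the two sides match term by term, and the moments with d <= n form a triangular system for the
  Newton means. The form is arbitrary and q may be even: instead of a normal form for
  \<open>h\<close>, surjectivity of trace and norm onto the fixed field supplies the vectors of
  prescribed norm.\<close>

locale quadratic_field =
  fixes q :: nat and field_type :: "'a::{field,finite} itself"
  assumes primepow_q: "primepow q" and card_field: "CARD('a) = q\<^sup>2"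
begin

definition fixed_field :: "'a set" where "fixed_field = {c. c ^ q = c}"

lemma q_gt_1: "q > 1"
  using primepow_gt_Suc_0[OF primepow_q] by simp

lemma card_field_gt_1: "CARD('a) > 1"
  unfolding card_field using one_less_power[OF q_gt_1, of 2] by simp

text \<open>The characteristic divides the order q^2, hence is the prime under \<open>q\<close>, and
  \<open>x ^ q\<close> is an iterate of the Frobenius map.\<close>

lemma power_q_add: "(x + y :: 'a) ^ q = x ^ q + y ^ q"
proof -
  obtain r e where r: "prime r" "e > 0" "q = r ^ e"
    using primepow_q unfolding primepow_def by blast
  have pos: "CHAR('a) > 0" by (intro finite_imp_CHAR_pos) auto
  then have pr: "prime CHAR('a)" by (rule prime_CHAR_semidom)
  have "CHAR('a) dvd q\<^sup>2" using CHAR_dvd_CARD[where ?'a='a] card_field by simp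
  then have "CHAR('a) = r"
    using pr r by (metis prime_dvd_power primes_dvd_imp_eq)
  then show ?thesis
    using freshmans_dream'[OF pr, of q e] r by simp
qed

lemma power_q_minus: "(- x :: 'a) ^ q = - (x ^ q)"
proof -
  have "(- x) ^ q + x ^ q = (- x + x) ^ q"
    by (simp only: power_q_add)
  then show ?thesis using q_gt_1 by (simp add: eq_neg_iff_add_eq_0)
qed

lemma power_q_diff: "(x - y :: 'a) ^ q = x ^ q - y ^ q"
  using power_q_add[of x "- y"] by (simp add: power_q_minus)

lemma power_q_power_q: "((x :: 'a) ^ q) ^ q = x"
proof (cases "x = 0")
  case False
  have "x ^ (CARD('a) - 1) * \<Prod>(UNIV - {0}) = (\<Prod>y\<in>UNIV - {0}. x * y)"
    by (simp add: prod.distrib)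
  also have "\<dots> = \<Prod>(UNIV - {0})"
    by (rule prod.reindex_bij_witness[of _ "\<lambda>y. y / x" "\<lambda>y. x * y"]) (use False in auto)
  finally have "x ^ (CARD('a) - 1) = 1" by simp
  moreover have "x ^ CARD('a) = x * x ^ (CARD('a) - 1)"
    by (metis card_0_eq finite UNIV_not_empty power_eq_if)
  ultimately show ?thesis
    by (simp add: card_field power2_eq_square power_mult)
qed (use q_gt_1 in simp)

lemma power_q_eq_0_iff [simp]: "(x :: 'a) ^ q = 0 \<longleftrightarrow> x = 0"
  using q_gt_1 by simp

lemma card_root_le:
  fixes p :: "'a poly"
  assumes "p \<noteq> 0" "\<And>x. x \<in> A \<Longrightarrow> poly p x = 0" "Polynomial.degree p \<le> m"
  shows "card A \<le> m"
proof -
  have "card A \<le> card {x. poly p x = 0}"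
    using assms by (intro card_mono poly_roots_finite) auto
  also have "\<dots> \<le> Polynomial.degree p" using assms by (intro card_poly_roots_bound)
  finally show ?thesis using assms by simp
qed

lemma trace_in_fixed_field: "x + x ^ q \<in> fixed_field"
  by (simp add: fixed_field_def power_q_add power_q_power_q add.commute)

lemma norm_in_fixed_field: "x * x ^ q \<in> fixed_field"
  by (simp add: fixed_field_def power_mult_distrib power_q_power_q mult.commute)

lemma card_fixed_field_le: "card fixed_field \<le> q"
  by (rule card_root_le[of "Polynomial.monom 1 q - Polynomial.monom 1 1"])
    (use q_gt_1 in \<open>auto simp: fixed_field_def poly_monom monom_eq_iff' degree_monom_eq
      intro!: degree_diff_le\<close>)

lemma card_trace_fiber_le: "card {x :: 'a. x + x ^ q = c} \<le> q"
proof (rule card_root_le[of "Polynomial.monom 1 q + Polynomial.monom 1 1 - Polynomial.monom c 0"])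
  have "Polynomial.coeff (Polynomial.monom 1 q + Polynomial.monom 1 1 - Polynomial.monom c 0) q = 1"
    using q_gt_1 by simp
  then show "Polynomial.monom 1 q + Polynomial.monom 1 1 - Polynomial.monom c 0 \<noteq> 0" by (metis coeff_0 zero_neq_one)
qed (use q_gt_1 in \<open>auto simp: poly_monom degree_monom_eq add.commute monom_0
      intro!: degree_diff_le degree_add_le\<close>)

lemma card_norm_fiber_le: "card {x :: 'a. x * x ^ q = c} \<le> q + 1"
proof (rule card_root_le[of "Polynomial.monom 1 (q + 1) - Polynomial.monom c 0"])
  have "Polynomial.coeff (Polynomial.monom 1 (q + 1) - Polynomial.monom c 0) (q + 1) = 1" by simp
  then show "Polynomial.monom 1 (q + 1) - Polynomial.monom c 0 \<noteq> 0" by (metis coeff_0 zero_neq_one)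
qed (auto simp: poly_monom degree_monom_eq monom_0 intro!: degree_diff_le)

text \<open>Pigeonhole: q^2 elements fall into fibres of at most q elements, being roots of a
  polynomial of degree q, over at most q values in \<open>fixed_field\<close>. So every estimate is
  sharp.\<close>

lemma trace_image: "range (\<lambda>x :: 'a. x + x ^ q) = fixed_field"
  and card_fixed_field: "card fixed_field = q"
proof -
  let ?R = "range (\<lambda>x :: 'a. x + x ^ q)"
  have sub: "?R \<subseteq> fixed_field" using trace_in_fixed_field by auto
  have "q * q = (\<Sum>c\<in>?R. card {x. x + x ^ q = c})"
    using sum.image_gen[of "UNIV :: 'a set" "\<lambda>_. 1 :: nat" "\<lambda>x. x + x ^ q"] card_field
    by (simp add: power2_eq_square)
  also have "\<dots> \<le> (\<Sum>c\<in>?R. q)" by (intro sum_mono card_trace_fiber_le)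
  finally have "q \<le> card ?R" using q_gt_1 by simp
  moreover have "card ?R \<le> card fixed_field" by (intro card_mono sub) simp
  ultimately have eq: "card ?R = card fixed_field" "card fixed_field = q"
    using card_fixed_field_le by linarith+
  show "?R = fixed_field" by (rule card_subset_eq[OF _ sub eq(1)]) simp
  show "card fixed_field = q" by (rule eq)
qed

text \<open>The same count with q^2 - 1 = (q - 1)(q + 1) nonzero elements and fibres of at most q +
  1.\<close>

lemma norm_image: "(\<lambda>x :: 'a. x * x ^ q) ` (- {0}) = fixed_field - {0}"
proof -
  let ?R = "(\<lambda>x :: 'a. x * x ^ q) ` (- {0})"
  have zero: "0 \<in> fixed_field" using q_gt_1 by (simp add: fixed_field_def)
  have sub: "?R \<subseteq> fixed_field - {0}" using norm_in_fixed_field by auto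
  have "(q - 1) * (q + 1) = card (- {0 :: 'a})"
    using card_field by (simp add: Compl_eq_Diff_UNIV power2_eq_square algebra_simps diff_mult_distrib)
  also have "\<dots> = (\<Sum>c\<in>?R. card {x \<in> - {0}. x * x ^ q = c})"
    using sum.image_gen[of "- {0 :: 'a}" "\<lambda>_. 1 :: nat" "\<lambda>x. x * x ^ q"] by simp
  also have "\<dots> \<le> (\<Sum>c\<in>?R. q + 1)"
    by (intro sum_mono order.trans[OF card_mono card_norm_fiber_le]) auto
  finally have "(q - 1) * (q + 1) \<le> card ?R * (q + 1)" by simp
  then have "q - 1 \<le> card ?R" by (simp only: mult_le_cancel2)
  moreover have "card (fixed_field - {0}) = q - 1" using card_fixed_field zero by simp
  ultimately show ?thesis using sub card_mono[OF _ sub] by (intro card_subset_eq) auto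
qed

text \<open>The witness is nonzero because \<open>witt_step\<close> divides by it. For c = 0 it is a
  difference of two elements of equal trace.\<close>

lemma obtain_trace:
  assumes "c ^ q = (c :: 'a)" obtains x where "x \<noteq> 0" "x + x ^ q = c"
proof (cases "c = 0")
  case False
  have "c \<in> range (\<lambda>x. x + x ^ q)" using assms trace_image by (simp add: fixed_field_def)
  then obtain x where "x + x ^ q = c" by auto
  moreover from this have "x \<noteq> 0" using False q_gt_1 by auto
  ultimately show ?thesis using that by blast
next
  case True
  have "\<not> inj (\<lambda>x :: 'a. x + x ^ q)"
  proof
    assume "inj (\<lambda>x :: 'a. x + x ^ q)"
    then have "card fixed_field = q\<^sup>2" using card_image card_field trace_image by metis
    then show False using card_fixed_field q_gt_1 by (simp add: power2_eq_square)
  qed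
  then obtain x y :: 'a where "x \<noteq> y" "x + x ^ q = y + y ^ q" unfolding inj_def by blast
  then show ?thesis using that[of "x - y"] True by (simp add: power_q_diff algebra_simps)
qed

lemma obtain_norm:
  assumes "c ^ q = (c :: 'a)" obtains x where "x * x ^ q = c"
proof (cases "c = 0")
  case False
  then have "c \<in> (\<lambda>x. x * x ^ q) ` (- {0})" using assms norm_image by (simp add: fixed_field_def)
  then show ?thesis using that by auto
qed (use that[of 0] in simp)

end

section \<open>Orthogonal complements in Hermitian spaces\<close>

text \<open>The form identities hold on the whole type and only nondegeneracy refers to
  \<open>V\<close>, which removes membership conditions from computations with the form. Dimensions
  appear as exponents of cardinalities, so \<open>n\<close> enters through
  \<open>card_V\<close>.\<close>

locale hermitian_space = vector_space scale + quadratic_field q "TYPE('a)"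
  for scale :: "'a::{field,finite} \<Rightarrow> 'v::ab_group_add \<Rightarrow> 'v" (infixr "*\<^sub>V" 75) and q +
  fixes n :: nat and h :: "'v \<Rightarrow> 'v \<Rightarrow> 'a" and V :: "'v set"
  assumes subspace_V: "subspace V" and card_V: "card V = CARD('a) ^ n"
    and form_add_left: "h (u + v) w = h u w + h v w"
    and form_scale_left: "h (c *\<^sub>V u) w = c * h u w"
    and form_swap: "h w u = h u w ^ q"
    and nondegenerate: "u \<in> V \<Longrightarrow> (\<And>w. w \<in> V \<Longrightarrow> h u w = 0) \<Longrightarrow> u = 0"
begin

lemma finite_V [simp]: "finite V"
  using card_V by (metis card.infinite card_gt_0_iff finite UNIV_not_empty power_eq_0_iff less_irrefl)

lemma finite_subset_V [simp]: "W \<subseteq> V \<Longrightarrow> finite W"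
  by (rule finite_subset[OF _ finite_V])

lemma form_add_right: "h u (v + w) = h u v + h u w"
  by (metis form_add_left form_swap power_q_add)

lemma form_scale_right: "h u (c *\<^sub>V w) = c ^ q * h u w"
  by (metis form_scale_left form_swap power_mult_distrib)

lemma form_zero_left [simp]: "h 0 w = 0"
  using form_scale_left[of 0 0 w] by simp

lemma form_minus_left: "h (- u) w = - h u w"
  using form_add_left[of u "- u" w] by (simp add: eq_neg_iff_add_eq_0 add.commute)

lemma form_diff_left: "h (u - v) w = h u w - h v w"
  using form_add_left[of u "- v" w] by (simp add: form_minus_left)

lemma form_zero_right [simp]: "h w 0 = 0"
  by (metis form_swap form_zero_left power_q_eq_0_iff)

lemma form_minus_right: "h u (- w) = - h u w"
  using form_add_right[of u w "- w"] by (simp add: eq_neg_iff_add_eq_0 add.commute)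

lemma form_diff_right: "h u (v - w) = h u v - h u w"
  using form_add_right[of u v "- w"] by (simp add: form_minus_right)

lemmas form_simps = form_add_left form_scale_left form_diff_left form_minus_left
  form_add_right form_scale_right form_diff_right form_minus_right

lemma form_swap_eq_0: "h u w = 0 \<longleftrightarrow> h w u = 0"
  by (metis form_swap power_q_eq_0_iff)

lemma form_self_in_fixed_field: "h u u \<in> fixed_field"
  unfolding fixed_field_def using form_swap[of u u] by simp

lemma in_span_insert:
  assumes "subspace W"
  shows "x \<in> span (insert v W) \<longleftrightarrow> (\<exists>c. \<exists>w\<in>W. x = c *\<^sub>V v + w)"
proof -
  have "x \<in> span (insert v W) \<longleftrightarrow> (\<exists>c. x - c *\<^sub>V v \<in> W)"
    using span_breakdown_eq[of x v W] iffD2[OF span_eq_iff assms] by simp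
  also have "\<dots> \<longleftrightarrow> (\<exists>c. \<exists>w\<in>W. x = c *\<^sub>V v + w)"
    by (metis add.commute diff_add_cancel add_diff_cancel_left')
  finally show ?thesis .
qed

lemma card_span_insert:
  assumes W: "subspace W" "finite W" and v: "v \<notin> W"
  shows "card (span (insert v W)) = CARD('a) * card W"
proof -
  have "span (insert v W) = (\<lambda>(c, w). c *\<^sub>V v + w) ` (UNIV \<times> W)"
    using in_span_insert[OF W(1)] by (auto simp: image_iff)
  moreover have "inj_on (\<lambda>(c, w). c *\<^sub>V v + w) (UNIV \<times> W)"
  proof (rule inj_onI, clarify)
    fix c c' w w' assume w: "w \<in> W" "w' \<in> W" and eq: "c *\<^sub>V v + w = c' *\<^sub>V v + w'"
    have "(c - c') *\<^sub>V v = w' - w" using eq by (simp add: scale_left_diff_distrib algebra_simps)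
    then have mem: "(c - c') *\<^sub>V v \<in> W" using w W by (simp add: subspace_diff)
    have "c = c'"
    proof (rule ccontr)
      assume "c \<noteq> c'"
      then have "v = inverse (c - c') *\<^sub>V ((c - c') *\<^sub>V v)" by simp
      then show False using v mem W(1) subspace_scale by metis
    qed
    then show "c = c' \<and> w = w'" using eq by simp
  qed
  ultimately show ?thesis by (simp add: card_image card_cartesian_product)
qed

lemma card_kernel:
  assumes W: "subspace W" "finite W" and y: "y \<in> W" "h y v \<noteq> 0"
  shows "card W = CARD('a) * card {x \<in> W. h x v = 0}"
proof -
  let ?K = "{x \<in> W. h x v = 0}"
  have K: "subspace ?K" using W(1)
    by (auto simp: subspace_def form_simps)
  have "span (insert y ?K) = W"
  proof
    show "span (insert y ?K) \<subseteq> W" by (rule span_minimal) (use W y in auto)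
    show "W \<subseteq> span (insert y ?K)"
    proof
      fix x assume x: "x \<in> W"
      let ?c = "h x v / h y v"
      have "x - ?c *\<^sub>V y \<in> ?K"
        using x y W by (simp add: subspace_diff subspace_scale form_simps)
      then show "x \<in> span (insert y ?K)"
        unfolding in_span_insert[OF K] by (metis add.commute diff_add_cancel)
    qed
  qed
  then show ?thesis using card_span_insert[OF K, of y] W y by simp
qed

definition perp :: "'v set \<Rightarrow> 'v set" where
  "perp W = {y \<in> V. \<forall>w\<in>W. h y w = 0}"

lemma subspace_perp: "subspace (perp W)"
  using subspace_V unfolding perp_def subspace_def by (simp add: form_simps)

lemma perp_subset_V: "perp W \<subseteq> V"
  by (auto simp: perp_def)

lemma finite_perp [simp]: "finite (perp W)"
  using perp_subset_V by simp

lemma perpD: "y \<in> perp W \<Longrightarrow> w \<in> W \<Longrightarrow> h y w = 0" "y \<in> perp W \<Longrightarrow> w \<in> W \<Longrightarrow> h w y = 0"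
  using form_swap_eq_0 by (auto simp: perp_def)

lemma perp_span: "perp (span W) = perp W"
proof
  show "perp W \<subseteq> perp (span W)"
  proof
    fix y assume y: "y \<in> perp W"
    have "subspace {w. h y w = 0}" by (auto simp: subspace_def form_simps)
    moreover have "W \<subseteq> {w. h y w = 0}" using y by (auto simp: perp_def)
    ultimately have "span W \<subseteq> {w. h y w = 0}" by (rule span_minimal[rotated])
    then show "y \<in> perp (span W)" using y by (auto simp: perp_def)
  qed
qed (auto simp: perp_def span_base)

lemma perp_insert: "perp (insert v W) = {y \<in> perp W. h y v = 0}"
  by (auto simp: perp_def)

text \<open>Adjoining one vector multiplies \<open>card U\<close> by \<open>CARD('a)\<close> and
  imposes one linear condition on \<open>perp U\<close>, which divides its order by at most
  \<open>CARD('a)\<close>.\<close>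

lemma card_perp_mono:
  assumes "subspace U" "subspace W" "U \<subseteq> W" "W \<subseteq> V"
  shows "card U * card (perp U) \<le> card W * card (perp W)"
  using assms
proof (induction "card W - card U" arbitrary: U rule: less_induct)
  case less
  have fin: "finite W" "finite U" using less.prems finite_subset_V by (auto intro: finite_subset)
  show ?case
  proof (cases "U = W")
    case False
    then obtain v where v: "v \<in> W" "v \<notin> U" using less.prems by blast
    let ?U = "span (insert v U)"
    have cU: "card ?U = CARD('a) * card U" using less.prems fin v by (intro card_span_insert)
    have sub: "?U \<subseteq> W" by (rule span_minimal) (use less.prems v in auto)
    have pos: "card U > 0" using fin less.prems(1) subspace_0 card_gt_0_iff by blast
    have "card U < card ?U" using cU pos card_field_gt_1 by simp
    then have "card W - card ?U < card W - card U"
      using card_mono[OF fin(1) sub] by linarith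
    then have IH: "card ?U * card (perp ?U) \<le> card W * card (perp W)"
      using less.hyps[of ?U] less.prems sub by simp
    have "card (perp U) \<le> CARD('a) * card (perp ?U)"
    proof (cases "\<exists>y\<in>perp U. h y v \<noteq> 0")
      case True
      then show ?thesis
        using card_kernel[OF subspace_perp finite_perp] by (force simp: perp_span perp_insert)
    next
      case False
      then have "perp ?U = perp U" by (auto simp: perp_span perp_insert)
      then show ?thesis using card_field q_gt_1 by simp
    qed
    then have "card U * card (perp U) \<le> card ?U * card (perp ?U)"
      by (simp add: cU mult_ac)
    then show ?thesis using IH by simp
  qed simp
qed

text \<open>The product is monotone in the subspace and equals \<open>card V\<close> at both ends:
  \<open>perp {0} = V\<close>, and \<open>perp V = {0}\<close> by nondegeneracy.\<close>

lemma card_perp: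
  assumes "subspace W" "W \<subseteq> V"
  shows "card W * card (perp W) = card V"
proof (rule antisym)
  have "perp V = {0}" using nondegenerate subspace_0[OF subspace_V] by (auto simp: perp_def)
  then show "card W * card (perp W) \<le> card V"
    using card_perp_mono[OF assms(1) subspace_V assms(2)] by simp
  have "perp {0} = V" by (auto simp: perp_def)
  then show "card V \<le> card W * card (perp W)"
    using card_perp_mono[of "{0}" W] assms subspace_0 by auto
qed

lemma perp_perp:
  assumes "subspace W" "W \<subseteq> V"
  shows "perp (perp W) = W"
proof (rule sym, rule card_subset_eq)
  show "W \<subseteq> perp (perp W)" using assms(2) by (auto simp: perp_def[of "perp W"] perpD)
  have "card (perp W) > 0" using subspace_0[OF subspace_perp] finite_perp card_gt_0_iff by blast
  moreover have "card W * card (perp W) = card (perp (perp W)) * card (perp W)"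
    using card_perp[OF assms] card_perp[OF subspace_perp perp_subset_V, of W] by (simp add: mult.commute)
  ultimately show "card W = card (perp (perp W))" by (metis mult_cancel2 less_irrefl)
qed simp

lemma card_subspace_power:
  assumes "subspace W" "W \<subseteq> V"
  shows "\<exists>k. card W = CARD('a) ^ k"
proof -
  have "\<exists>k. card W = CARD('a) ^ k * card U" if "subspace U" "U \<subseteq> W" for U
    using that
  proof (induction "card W - card U" arbitrary: U rule: less_induct)
    case less
    have fin: "finite W" "finite U" using less.prems assms finite_subset_V by (auto intro: finite_subset)
    show ?case
    proof (cases "U = W")
      case False
      then obtain v where v: "v \<in> W" "v \<notin> U" using less.prems by blast
      let ?U = "span (insert v U)"
      have cU: "card ?U = CARD('a) * card U" using less.prems fin v by (intro card_span_insert)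
      have sub: "?U \<subseteq> W" by (rule span_minimal) (use less.prems assms v in auto)
      have pos: "card U > 0" using fin less.prems(1) subspace_0 card_gt_0_iff by blast
      have "card U < card ?U" using cU pos card_field_gt_1 by simp
      then have "card W - card ?U < card W - card U"
        using card_mono[OF fin(1) sub] by linarith
      then obtain k where "card W = CARD('a) ^ k * card ?U"
        using less.hyps[of ?U] sub by auto
      then show ?thesis using cU by (intro exI[of _ "Suc k"]) simp
    qed (auto intro: exI[of _ 0])
  qed
  from this[of "{0}"] show ?thesis using assms subspace_0 by auto
qed

end

section \<open>Witt's theorem and orbit counting\<close>

context hermitian_space
begin

text \<open>Extensionality outside \<open>V\<close> makes the set finite and lets it correspond to
  matrices. Bijectivity follows: nondegeneracy gives injectivity, and \<open>V\<close> is
  finite.\<close>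

definition isometries :: "('v \<Rightarrow> 'v) set" where
  "isometries = {g \<in> V \<rightarrow>\<^sub>E V.
     (\<forall>u\<in>V. \<forall>v\<in>V. g (u + v) = g u + g v) \<and> (\<forall>c. \<forall>u\<in>V. g (c *\<^sub>V u) = c *\<^sub>V g u) \<and>
     (\<forall>u\<in>V. \<forall>v\<in>V. h (g u) (g v) = h u v)}"

definition stab :: "'v set \<Rightarrow> ('v \<Rightarrow> 'v) set" where
  "stab W = {g \<in> isometries. \<forall>w\<in>W. g w = w}"

lemma isometriesD:
  assumes "g \<in> isometries"
  shows "u \<in> V \<Longrightarrow> g u \<in> V" "u \<in> V \<Longrightarrow> v \<in> V \<Longrightarrow> g (u + v) = g u + g v"
    "u \<in> V \<Longrightarrow> g (c *\<^sub>V u) = c *\<^sub>V g u" "u \<in> V \<Longrightarrow> v \<in> V \<Longrightarrow> h (g u) (g v) = h u v"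
    "g \<in> extensional V"
  using assms by (auto simp: isometries_def PiE_iff)

lemma finite_isometries [simp]: "finite isometries"
  by (rule finite_subset[of _ "V \<rightarrow>\<^sub>E V"]) (auto simp: isometries_def intro!: finite_PiE)

lemma finite_stab [simp]: "finite (stab W)"
  by (rule finite_subset[OF _ finite_isometries]) (auto simp: stab_def)

lemma identity_in_isometries: "restrict (\<lambda>v. v) V \<in> isometries"
  using subspace_V by (auto simp: isometries_def subspace_add subspace_scale)

lemma subspace_fixed_space:
  assumes gi: "g \<in> isometries"
  shows "subspace {v \<in> V. g v = v}"
  using subspace_V isometriesD[OF gi] isometriesD(3)[OF gi, of 0 0] by (auto simp: subspace_def)

lemma isometry_inj:
  assumes "g \<in> isometries"
  shows "inj_on g V"
proof (rule inj_onI)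
  fix u v assume uv: "u \<in> V" "v \<in> V" and eq: "g u = g v"
  have "u - v = 0"
  proof (rule nondegenerate)
    show "u - v \<in> V" using uv subspace_V by (simp add: subspace_diff)
    fix w assume w: "w \<in> V"
    have "h (u - v) w = h (g u - g v) (g w)"
      using assms uv w by (simp add: form_simps isometriesD)
    then show "h (u - v) w = 0" using eq by simp
  qed
  then show "u = v" by simp
qed

lemma compose_in_stab:
  assumes "f \<in> stab W" "g \<in> stab W" "W \<subseteq> V"
  shows "compose V g f \<in> stab W"
proof -
  have f: "f \<in> isometries" and g: "g \<in> isometries" using assms by (auto simp: stab_def)
  have "compose V g f \<in> V \<rightarrow>\<^sub>E V"
    using isometriesD(1)[OF f] isometriesD(1)[OF g] by (auto simp: compose_def)
  then have "compose V g f \<in> isometries"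
    using isometriesD(1-4)[OF f] isometriesD(1-4)[OF g] subspace_V
    by (auto simp: isometries_def compose_eq subspace_add subspace_scale)
  then show ?thesis using assms by (auto simp: stab_def compose_eq subset_iff)
qed

text \<open>The condition on \<open>a\<close> is what makes the cross terms cancel. For isotropic
  \<open>w\<close> it says that \<open>a\<close> has trace zero, and the map is a
  transvection.\<close>

lemma quasi_reflection_in_isometries:
  assumes w: "w \<in> V" and a: "a + a ^ q = a * a ^ q * h w w"
  shows "(\<lambda>x\<in>V. x - (a * h x w) *\<^sub>V w) \<in> isometries"
proof -
  let ?t = "\<lambda>x. x - (a * h x w) *\<^sub>V w"
  have "h (?t x) (?t y) = h x y" for x y
  proof -
    have "h (?t x) (?t y) = h x y - h x w * h w y * (a + a ^ q - a * a ^ q * h w w)"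
      unfolding form_simps power_mult_distrib form_swap[of w y, symmetric]
      by (simp add: algebra_simps)
    then show ?thesis using a by simp
  qed
  then show ?thesis using w subspace_V
    by (auto simp: isometries_def subspace_add subspace_scale subspace_diff form_simps
        scale_left_distrib scale_right_diff_distrib algebra_simps)
qed

text \<open>With w = u - v and a = 1 / h u w the quasi-reflection sends u to u - w = v, and it fixes
  \<open>W\<close> because w is orthogonal to it. Equal norms give h w w = h u w + (h u w)^q, which
  is the required condition on a.\<close>

lemma witt_step_generic:
  assumes V: "u \<in> V" "v \<in> V" and perp: "u - v \<in> perp W"
    and norm: "h u u = h v v" and ne: "h u (u - v) \<noteq> 0" and W: "W \<subseteq> V"
  shows "\<exists>g\<in>stab W. g u = v"
proof -
  define w where "w = u - v"
  define a where "a = inverse (h u w)"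
  have w: "w \<in> V" using perp perp_subset_V w_def by auto
  have hw: "h w w = h u w + h u w ^ q"
    unfolding w_def form_simps power_q_diff form_swap[of u u, symmetric] form_swap[of v u, symmetric]
    using norm by simp
  have ne': "h u w \<noteq> 0" using ne w_def by simp
  have "a + a ^ q = a * a ^ q * h w w"
    unfolding hw a_def power_inverse[symmetric] using ne' by (simp add: field_simps)
  then have "(\<lambda>x\<in>V. x - (a * h x w) *\<^sub>V w) \<in> isometries"
    using w by (rule quasi_reflection_in_isometries[rotated])
  then have "(\<lambda>x\<in>V. x - (a * h x w) *\<^sub>V w) \<in> stab W"
    using W perpD(2)[OF perp] by (auto simp: stab_def w_def subset_iff)
  moreover have "(\<lambda>x\<in>V. x - (a * h x w) *\<^sub>V w) u = v"
    using V ne' by (simp add: a_def w_def)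
  ultimately show ?thesis by blast
qed

text \<open>
  When the quasi-reflection along \<open>u - v\<close> degenerates, we pass through a vector \<open>u + y\<close> of the same norm
  with \<open>y\<close> orthogonal to neither \<open>u\<close> nor \<open>v\<close>, so that both steps are quasi-reflections.
\<close>
lemma witt_step:
  assumes W: "subspace W" "W \<subseteq> V" and u: "u \<in> V" "u \<notin> W" and v: "v \<in> V" "v \<notin> W"
    and perp: "u - v \<in> perp W" and norm: "h u u = h v v"
  shows "\<exists>g\<in>stab W. g u = v"
proof (cases "h u (u - v) = 0")
  case True
  have ex: "\<exists>y\<in>perp W. h y x \<noteq> 0" if "x \<in> V" "x \<notin> W" for x
  proof (rule ccontr)
    assume "\<not> ?thesis"
    then have "x \<in> perp (perp W)" using that by (auto simp: perp_def[of "perp W"] form_swap_eq_0)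
    then show False using perp_perp[OF W] that by simp
  qed
  obtain y1 y2 where y: "y1 \<in> perp W" "h y1 u \<noteq> 0" "y2 \<in> perp W" "h y2 v \<noteq> 0"
    using ex u v by blast
  \<comment> \<open>A vector space is not the union of two proper subspaces: if \<open>y1\<close> is
    orthogonal to \<open>v\<close> and \<open>y2\<close> to \<open>u\<close>, then
    \<open>y1 + y2\<close> is orthogonal to neither.\<close>
  have "\<exists>y\<in>perp W. h y u \<noteq> 0 \<and> h y v \<noteq> 0"
  proof (cases "h y1 v \<noteq> 0 \<or> h y2 u \<noteq> 0")
    case False
    then have "h (y1 + y2) u \<noteq> 0" "h (y1 + y2) v \<noteq> 0" using y by (auto simp: form_simps)
    then show ?thesis using y subspace_add[OF subspace_perp] by blast
  qed (use y in blast)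
  then obtain z where z: "z \<in> perp W" "h z u \<noteq> 0" "h z v \<noteq> 0" by blast
  have "(- h z z) ^ q = - h z z" using form_swap[of z z] by (simp add: power_q_minus)
  then obtain x where x: "x \<noteq> 0" "x + x ^ q = - h z z" by (rule obtain_trace)
  define t where "t = h u z"
  have t: "t \<noteq> 0" "h z u = t ^ q"
    using z form_swap_eq_0[of u z] form_swap[of z u] unfolding t_def by blast+
  \<comment> \<open>The scalar makes h y y + h u y + h y u equal to t t^q (h z z + x + x^q) / (x
    x^q), which is 0 by the choice of x. Thus u + y keeps the norm of u.\<close>
  define y where "y = (t / x) *\<^sub>V z"
  have yperp: "y \<in> perp W" using z subspace_perp by (simp add: y_def subspace_scale)
  have "h y y + h u y + h y u = t * t ^ q * (h z z + x + x ^ q) / (x * x ^ q)"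
    using x(1) t by (simp add: y_def form_simps power_divide t_def[symmetric] field_simps)
  then have yy: "h y y + h u y + h y u = 0" using x(2) by (simp add: add.assoc)
  have "h y u \<noteq> 0" "h u y \<noteq> 0" "h y v \<noteq> 0"
    using z t x(1) by (auto simp: y_def form_simps t_def[symmetric])
  have yV: "y \<in> V" using yperp perp_subset_V by auto
  then have uyV: "u + y \<in> V" using u subspace_V subspace_add by blast
  have norm': "h (u + y) (u + y) = h u u" using yy by (simp add: form_simps algebra_simps)
  have "\<exists>g\<in>stab W. g u = u + y"
    using u(1) uyV _ norm'[symmetric] _ W(2)
  proof (rule witt_step_generic)
    show "u - (u + y) \<in> perp W" using yperp subspace_perp by (simp add: subspace_neg)
    show "h u (u - (u + y)) \<noteq> 0" using \<open>h u y \<noteq> 0\<close> by (simp add: form_simps)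
  qed
  moreover have "\<exists>g\<in>stab W. g (u + y) = v"
    using uyV v(1) _ _ _ W(2)
  proof (rule witt_step_generic)
    have "y + (u - v) \<in> perp W" using yperp perp subspace_perp subspace_add by blast
    then show "u + y - v \<in> perp W" by (simp add: algebra_simps)
    show "h (u + y) (u + y) = h v v" using norm norm' by simp
    have "h (u + y) (u + y - v) = (h y y + h u y + h y u) + h u (u - v) - h y v"
      by (simp add: form_simps algebra_simps)
    then show "h (u + y) (u + y - v) \<noteq> 0" using True yy \<open>h y v \<noteq> 0\<close> by simp
  qed
  ultimately obtain f g where "f \<in> stab W" "f u = u + y" "g \<in> stab W" "g (u + y) = v" by blast
  then show ?thesis using compose_in_stab[of f W g] W u
    by (intro bexI[of _ "compose V g f"]) (auto simp: compose_eq)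
qed (use assms in \<open>blast intro: witt_step_generic\<close>)

text \<open>New row and diagonal entry of the Gram matrix when \<open>v\<close> is adjoined to
  \<open>W\<close>. By \<open>witt_step\<close> they separate the orbits of \<open>stab W\<close> on
  \<open>V - W\<close>.\<close>

definition invariants :: "'v set \<Rightarrow> 'v \<Rightarrow> ('v \<Rightarrow> 'a) \<times> 'a" where
  "invariants W v = (restrict (h v) W, h v v)"

lemma restrict_form_eq_iff:
  assumes "u \<in> V" "v \<in> V"
  shows "restrict (h u) W = restrict (h v) W \<longleftrightarrow> u - v \<in> perp W"
proof -
  have "restrict (h u) W = restrict (h v) W \<longleftrightarrow> (\<forall>w\<in>W. h u w = h v w)"
    by (metis restrict_apply' restrict_ext)
  then show ?thesis
    using assms subspace_V by (auto simp: perp_def form_simps subspace_diff)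
qed

lemma stab_preserves:
  assumes "g \<in> stab W" "W \<subseteq> V" "v \<in> V"
  shows "invariants W (g v) = invariants W v"
proof -
  have g: "g \<in> isometries" using assms by (simp add: stab_def)
  have "h (g v) w = h v w" if "w \<in> W" for w
    using isometriesD(4)[OF g assms(3), of w] assms that by (auto simp: stab_def subset_iff)
  then show ?thesis using isometriesD(4)[OF g assms(3,3)] by (auto simp: invariants_def)
qed

text \<open>Orbit-stabilizer summed over \<open>A\<close>: the stabilizers along one orbit add up to
  \<open>card (stab W)\<close>, and the orbits correspond to the values of
  \<open>invariants W\<close>.\<close>

lemma sum_card_stab:
  assumes W: "subspace W" "W \<subseteq> V" and A: "A \<subseteq> V - W"
    and closed: "\<And>g v. g \<in> stab W \<Longrightarrow> v \<in> A \<Longrightarrow> g v \<in> A"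
  shows "(\<Sum>v\<in>A. card (stab (insert v W))) = card (stab W) * card (invariants W ` A)"
proof -
  have fin: "finite A" using A finite_subset_V by blast
  have stab_eq: "stab (insert v W) = {g \<in> stab W. g v = v}" for v by (auto simp: stab_def)
  \<comment> \<open>If \<open>f\<close> fixes \<open>W\<close> and sends \<open>v\<close> to
    \<open>u\<close>, composition with \<open>f\<close> injects the maps sending \<open>u\<close> to
    \<open>x\<close> into those sending \<open>v\<close> to \<open>x\<close>. By symmetry the two
    counts agree, without forming inverses.\<close>
  have le: "card {g \<in> stab W. g u = x} \<le> card {g \<in> stab W. g v = x}"
    if uv: "u \<in> A" "v \<in> A" "invariants W u = invariants W v" for u v x
  proof -
    have "\<exists>g\<in>stab W. g v = u"
      using that A restrict_form_eq_iff[of v u W]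
      by (intro witt_step W) (auto simp: invariants_def)
    then obtain f where f: "f \<in> stab W" "f v = u" by blast
    have fi: "f \<in> isometries" using f by (simp add: stab_def)
    have surj: "f ` V = V"
      using isometry_inj[OF fi] isometriesD(1)[OF fi]
      by (intro card_subset_eq) (auto simp: card_image)
    show ?thesis
    proof (rule card_inj_on_le[of "\<lambda>g. compose V g f"])
      show "inj_on (\<lambda>g. compose V g f) {g \<in> stab W. g u = x}"
      proof (rule inj_onI)
        fix g g' assume gg: "g \<in> {g \<in> stab W. g u = x}" "g' \<in> {g \<in> stab W. g u = x}"
          and eq: "compose V g f = compose V g' f"
        have ext: "g \<in> extensional V" "g' \<in> extensional V"
          using gg isometriesD(5) by (auto simp: stab_def)
        show "g = g'"
        proof (rule extensionalityI[OF ext])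
          fix z assume "z \<in> V"
          then obtain y where "y \<in> V" "z = f y" using surj by blast
          then show "g z = g' z" using fun_cong[OF eq, of y] by (simp add: compose_eq)
        qed
      qed
      show "(\<lambda>g. compose V g f) ` {g \<in> stab W. g u = x} \<subseteq> {g \<in> stab W. g v = x}"
        using f W A uv compose_in_stab[OF f(1)] by (auto simp: compose_eq)
    qed simp
  qed
  have "(\<Sum>v\<in>A. card (stab (insert v W))) =
      (\<Sum>c\<in>invariants W ` A. \<Sum>v\<in>{v \<in> A. invariants W v = c}. card (stab (insert v W)))"
    by (rule sum.image_gen[OF fin])
  also have "\<dots> = (\<Sum>c\<in>invariants W ` A. card (stab W))"
  proof (rule sum.cong[OF refl])
    fix c assume "c \<in> invariants W ` A"
    then obtain u where u: "u \<in> A" "invariants W u = c" by blast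
    let ?F = "{v \<in> A. invariants W v = c}"
    have "(\<Sum>v\<in>?F. card (stab (insert v W))) = (\<Sum>v\<in>?F. card {g \<in> stab W. g u = v})"
      unfolding stab_eq by (rule sum.cong[OF refl], rule antisym; rule le) (use u in auto)
    also have "\<dots> = (\<Sum>v\<in>(\<lambda>g. g u) ` stab W. card {g \<in> stab W. g u = v})"
    proof (rule sum.mono_neutral_right)
      show "(\<lambda>g. g u) ` stab W \<subseteq> ?F"
        using closed u W A stab_preserves by (auto simp: subset_iff)
    qed (use fin in auto)
    also have "\<dots> = card (stab W)"
      using sum.image_gen[of "stab W" "\<lambda>_. 1 :: nat" "\<lambda>g. g u"] by simp
    finally show "(\<Sum>v\<in>?F. card (stab (insert v W))) = card (stab W)" .
  qed
  finally show ?thesis by (simp add: mult.commute)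
qed

section \<open>Radicals and their change when one vector is adjoined\<close>

definition rad :: "'v set \<Rightarrow> 'v set" where
  "rad W = W \<inter> perp W"

lemma subspace_rad: "subspace W \<Longrightarrow> subspace (rad W)"
  unfolding rad_def by (intro subspace_inter subspace_perp)

lemma rad_subset: "rad W \<subseteq> W" "rad W \<subseteq> perp W" "rad W \<subseteq> V"
  using perp_subset_V by (auto simp: rad_def)

text \<open>The complement of W + perp W is the intersection of perp W with perp (perp W) = W, that
  is \<open>rad W\<close>; taking complements again gives the claim. It yields the case distinction
  of \<open>extensions_cases\<close>.\<close>

lemma perp_rad:
  assumes W: "subspace W" "W \<subseteq> V"
  shows "perp (rad W) = {w + y |w y. w \<in> W \<and> y \<in> perp W}"
proof -
  have "perp (span (W \<union> perp W)) = perp W \<inter> perp (perp W)"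
    unfolding perp_span by (auto simp: perp_def)
  then have "perp (span (W \<union> perp W)) = rad W"
    using perp_perp[OF W] by (auto simp: rad_def)
  moreover have "span (W \<union> perp W) \<subseteq> V"
    using W subspace_V perp_subset_V by (intro span_minimal) auto
  ultimately have "perp (rad W) = span (W \<union> perp W)"
    using perp_perp[of "span (W \<union> perp W)"] by simp
  then show ?thesis
    using iffD2[OF span_eq_iff W(1)] iffD2[OF span_eq_iff subspace_perp] by (simp add: span_Un)
qed

text \<open>Some \<open>r\<close> in the radical pairs nontrivially with \<open>v\<close>. Testing a
  new radical vector c v + w against \<open>r\<close> forces c = 0, so the new radical is the kernel
  of the pairing with \<open>v\<close> on the old one.\<close>

lemma rad_span_insert_kernel:
  assumes W: "subspace W" "W \<subseteq> V" and v: "v \<in> V" "v \<notin> perp (rad W)"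
  shows "card (rad W) = CARD('a) * card (rad (span (insert v W)))"
proof -
  obtain r where r: "r \<in> rad W" "h v r \<noteq> 0" using v by (auto simp: perp_def)
  have "rad (span (insert v W)) = {x \<in> rad W. h x v = 0}"
  proof (intro equalityI subsetI)
    fix x assume x: "x \<in> rad (span (insert v W))"
    then have xp: "x \<in> perp W" "h x v = 0" by (auto simp: rad_def perp_span perp_insert)
    have "x \<in> span (insert v W)" using x by (auto simp: rad_def)
    then obtain c w where cw: "w \<in> W" "x = c *\<^sub>V v + w" using in_span_insert[OF W(1)] by auto
    have "h x r = 0" using xp r by (auto simp: rad_def perpD)
    moreover have "h w r = 0" using r cw by (auto simp: rad_def perpD)
    ultimately have "c = 0" using r cw by (simp add: form_simps)
    then show "x \<in> {x \<in> rad W. h x v = 0}" using cw xp by (simp add: rad_def)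
  qed (use W in \<open>auto simp: rad_def perp_span perp_insert span_base\<close>)
  then show ?thesis
    using card_kernel[OF subspace_rad[OF W(1)] _ r(1), of v] r(2) rad_subset(3) finite_subset_V
      form_swap_eq_0 by metis
qed

lemma span_insert_add:
  assumes "subspace W" "w \<in> W"
  shows "span (insert (w + y) W) = span (insert y W)"
proof (rule span_eq[THEN iffD2], intro conjI)
  have "w \<in> span (insert (w + y) W)" "w \<in> span (insert y W)" using assms by (auto intro: span_base)
  moreover have "w + y \<in> span (insert (w + y) W)" "y \<in> span (insert y W)" by (auto intro: span_base)
  ultimately have "w + y \<in> span (insert y W)" "y \<in> span (insert (w + y) W)"
    using span_add_eq by blast+
  then show "insert (w + y) W \<subseteq> span (insert y W)" "insert y W \<subseteq> span (insert (w + y) W)"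
    by (auto intro: span_base)
qed

lemma card_rad_span_insert_perp:
  assumes W: "subspace W" "W \<subseteq> V" and y: "y \<in> perp W" "y \<notin> W"
  shows "card (rad (span (insert y W))) = (if h y y = 0 then CARD('a) * card (rad W) else card (rad W))"
proof -
  have iff: "x \<in> rad (span (insert y W)) \<longleftrightarrow> (\<exists>c. \<exists>w\<in>rad W. x = c *\<^sub>V y + w \<and> c * h y y = 0)" for x
  proof
    assume x: "x \<in> rad (span (insert y W))"
    then have xp: "x \<in> perp W" "h x y = 0" by (auto simp: rad_def perp_span perp_insert)
    have "x \<in> span (insert y W)" using x by (auto simp: rad_def)
    then obtain c w where cw: "w \<in> W" "x = c *\<^sub>V y + w" using in_span_insert[OF W(1)] by auto
    have "w = x - c *\<^sub>V y" using cw by simp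
    then have "w \<in> perp W" using xp y subspace_perp by (simp add: subspace_diff subspace_scale)
    then have "w \<in> rad W" using cw by (simp add: rad_def)
    moreover have "h w y = 0" using cw y by (simp add: perpD)
    ultimately show "\<exists>c. \<exists>w\<in>rad W. x = c *\<^sub>V y + w \<and> c * h y y = 0"
      using cw xp by (auto simp: form_simps)
  next
    assume "\<exists>c. \<exists>w\<in>rad W. x = c *\<^sub>V y + w \<and> c * h y y = 0"
    then obtain c w where cw: "w \<in> rad W" "x = c *\<^sub>V y + w" "c * h y y = 0" by blast
    have "h w y = 0" using cw y by (simp add: perpD rad_def)
    moreover have "x \<in> perp W"
      using cw y subspace_perp by (simp add: subspace_add subspace_scale rad_def)
    moreover have "x \<in> span (insert y W)" using cw in_span_insert[OF W(1)] by (auto simp: rad_def)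
    ultimately show "x \<in> rad (span (insert y W))"
      using cw by (auto simp: rad_def perp_span perp_insert form_simps)
  qed
  show ?thesis
  proof (cases "h y y = 0")
    case True
    then have "rad (span (insert y W)) = span (insert y (rad W))"
      using iff in_span_insert[OF subspace_rad[OF W(1)]] by auto
    moreover have "card (span (insert y (rad W))) = CARD('a) * card (rad W)"
      using y rad_subset(3) finite_subset_V
      by (intro card_span_insert subspace_rad W) (auto simp: rad_def)
    ultimately show ?thesis using True by simp
  next
    case False
    then have "rad (span (insert y W)) = rad W" using iff by auto
    then show ?thesis using False by simp
  qed
qed

text \<open>Inside \<open>X\<close> the fibres of restriction to \<open>W\<close> are translates of
  \<open>K\<close>. It serves for \<open>X = W\<close>, \<open>K = rad W\<close> and for
  \<open>X = V - perp (rad W)\<close>, \<open>K = perp W\<close>.\<close>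

lemma card_restrict_form_image:
  assumes X: "X \<subseteq> V" and K: "K \<subseteq> perp W" "subspace K"
    and iff: "\<And>u v. u \<in> X \<Longrightarrow> v \<in> V \<Longrightarrow> u - v \<in> perp W \<Longrightarrow> v \<in> X \<longleftrightarrow> u - v \<in> K"
  shows "card ((\<lambda>v. restrict (h v) W) ` X) * card K = card X"
proof -
  let ?r = "\<lambda>v. restrict (h v) W"
  have fin: "finite X" using X by simp
  have "card X = (\<Sum>c\<in>?r ` X. card {v \<in> X. ?r v = c})"
    using sum.image_gen[OF fin, of "\<lambda>_. 1 :: nat" ?r] by simp
  also have "\<dots> = (\<Sum>c\<in>?r ` X. card K)"
  proof (rule sum.cong[OF refl])
    fix c assume "c \<in> ?r ` X"
    then obtain u where u: "u \<in> X" "c = ?r u" by blast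
    have "{v \<in> X. ?r v = c} = (\<lambda>k. u - k) ` K"
    proof (intro equalityI subsetI)
      fix v assume v: "v \<in> {v \<in> X. ?r v = c}"
      then have "u - v \<in> perp W" using u X restrict_form_eq_iff[of u v W] by auto
      then have "u - v \<in> K" using iff[of u v] u v X by auto
      then show "v \<in> (\<lambda>k. u - k) ` K" by (intro image_eqI[of _ _ "u - v"]) auto
    next
      fix v assume "v \<in> (\<lambda>k. u - k) ` K"
      then obtain k where k: "k \<in> K" "v = u - k" by blast
      then have "v \<in> V" using u X K perp_subset_V subspace_V by (auto intro!: subspace_diff)
      moreover have "u - v \<in> perp W" "u - v \<in> K" using k K by auto
      ultimately show "v \<in> {v \<in> X. ?r v = c}"
        using u X iff[of u v] restrict_form_eq_iff[of u v W] by auto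
    qed
    then show "card {v \<in> X. ?r v = c} = card K" by (simp add: card_image inj_on_def)
  qed
  finally show ?thesis by simp
qed

text \<open>The functional of w + y on \<open>W\<close> is that of w; it determines w up to
  \<open>rad W\<close>, hence also h w w. What remains free is the norm of y, so functionals of
  \<open>W\<close> and norms on \<open>Y\<close> index the invariants.\<close>

lemma card_invariants_perp_translates:
  assumes W: "subspace W" "W \<subseteq> V" and Y: "Y \<subseteq> perp W"
  shows "card (invariants W ` {w + y |w y. w \<in> W \<and> y \<in> Y}) * card (rad W)
    = card W * card ((\<lambda>y. h y y) ` Y)"
proof -
  let ?r = "\<lambda>v. restrict (h v) W"
  define m where "m \<alpha> = (let w = inv_into W ?r \<alpha> in h w w)" for \<alpha>
  have m: "m (?r w) = h w w" if w: "w \<in> W" for w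
  proof -
    define w' where "w' = inv_into W ?r (?r w)"
    have w': "w' \<in> W" "?r w' = ?r w"
      using w inv_into_into[of "?r w" ?r W] f_inv_into_f[of "?r w" ?r W] by (auto simp: w'_def)
    then have "w' - w \<in> perp W" using restrict_form_eq_iff[of w' w W] W w by auto
    then have "h (w' - w) w' = 0" "h w (w' - w) = 0" using w w' by (auto simp: perpD)
    then have "h w' w' = h w w" by (simp add: form_simps)
    then show ?thesis by (simp add: m_def w'_def)
  qed
  have inv: "invariants W (w + y) = (?r w, h w w + h y y)" if "w \<in> W" "y \<in> Y" for w y
  proof -
    have "?r (w + y) = ?r w"
      using that W Y perp_subset_V subspace_V restrict_form_eq_iff[of "w + y" w W]
      by (auto intro!: subspace_add)
    moreover have "h w y = 0" "h y w = 0" using that Y by (auto simp: perpD)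
    ultimately show ?thesis by (simp add: invariants_def form_simps)
  qed
  have "invariants W ` {w + y |w y. w \<in> W \<and> y \<in> Y}
    = (\<lambda>(\<alpha>, c). (\<alpha>, m \<alpha> + c)) ` (?r ` W \<times> (\<lambda>y. h y y) ` Y)"
    by (force simp: inv m image_iff)
  moreover have "inj_on (\<lambda>(\<alpha>, c). (\<alpha>, m \<alpha> + c)) (?r ` W \<times> (\<lambda>y. h y y) ` Y)"
    by (auto simp: inj_on_def)
  ultimately have "card (invariants W ` {w + y |w y. w \<in> W \<and> y \<in> Y})
      = card (?r ` W) * card ((\<lambda>y. h y y) ` Y)"
    by (simp add: card_image card_cartesian_product)
  moreover have "card (?r ` W) * card (rad W) = card W"
  proof (rule card_restrict_form_image)
    fix u v assume "u \<in> W" "v \<in> V" "u - v \<in> perp W"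
    moreover have "v = u - (u - v)" by simp
    ultimately show "v \<in> W \<longleftrightarrow> u - v \<in> rad W"
      using W by (metis IntD1 IntI rad_def subspace_diff)
  qed (use W rad_subset subspace_rad in auto)
  ultimately show ?thesis by (simp add: mult_ac)
qed

text \<open>Adding a multiple of a radical vector r with h v r nonzero keeps the functional on
  \<open>W\<close> and shifts the norm by any trace, so the norm is arbitrary in
  \<open>fixed_field\<close>. The functionals are those that do not vanish on \<open>rad W\<close>;
  multiplying by \<open>card (rad W)\<close> keeps the count free of division.\<close>

lemma card_invariants_generic:
  assumes W: "subspace W" "W \<subseteq> V"
  shows "card (invariants W ` (V - perp (rad W))) * card (rad W) = q * (card W * card (rad W) - card W)"
proof -
  let ?r = "\<lambda>v. restrict (h v) W" and ?A = "V - perp (rad W)"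
  have "invariants W ` ?A = ?r ` ?A \<times> fixed_field"
  proof (intro equalityI subsetI)
    fix z assume "z \<in> ?r ` ?A \<times> fixed_field"
    then obtain v c where v: "v \<in> ?A" and c: "c \<in> fixed_field" and z: "z = (?r v, c)" by auto
    obtain r where r: "r \<in> rad W" "h v r \<noteq> 0" using v by (auto simp: perp_def)
    have "(c - h v v) ^ q = c - h v v"
      using c form_self_in_fixed_field[of v] by (simp add: power_q_diff fixed_field_def)
    then obtain x where x: "x + x ^ q = c - h v v" by (rule obtain_trace)
    have "h r v \<noteq> 0" using r form_swap_eq_0 by blast
    define l where "l = x / h r v"
    have l: "l * h r v = x" using \<open>h r v \<noteq> 0\<close> by (simp add: l_def)
    have l': "l ^ q * h v r = x ^ q"
      unfolding form_swap[of v r] l[symmetric] by (simp add: power_mult_distrib)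
    have "h r r = 0" using r by (auto simp: rad_def perpD)
    have "h (v + l *\<^sub>V r) (v + l *\<^sub>V r) = h v v + l * h r v + l ^ q * h v r"
      using \<open>h r r = 0\<close> by (simp add: form_simps)
    then have norm: "h (v + l *\<^sub>V r) (v + l *\<^sub>V r) = c"
      using x l l' by (simp add: add.assoc)
    have lr: "l *\<^sub>V r \<in> rad W" using r subspace_rad W by (simp add: subspace_scale)
    have "v + l *\<^sub>V r \<in> V"
      using v lr rad_subset(3) subspace_V by (auto intro!: subspace_add)
    moreover have "h (v + l *\<^sub>V r) r = h v r" using \<open>h r r = 0\<close> by (simp add: form_simps)
    ultimately have mem: "v + l *\<^sub>V r \<in> ?A"
      using r by (auto simp: perp_def intro!: bexI[of _ r])
    have "?r (v + l *\<^sub>V r) = ?r v"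
      using restrict_form_eq_iff[of "v + l *\<^sub>V r" v W] mem v lr rad_subset by auto
    then have "z = invariants W (v + l *\<^sub>V r)" using norm z by (simp add: invariants_def)
    then show "z \<in> invariants W ` ?A" using mem by blast
  qed (auto simp: invariants_def form_self_in_fixed_field)
  then have 0: "card (invariants W ` ?A) = card (?r ` ?A) * q"
    by (simp add: card_cartesian_product card_fixed_field)
  have 1: "card (?r ` ?A) * card (perp W) = card ?A"
  proof (rule card_restrict_form_image)
    fix u v assume u: "u \<in> ?A" and v: "v \<in> V" and uv: "u - v \<in> perp W"
    have "v \<notin> perp (rad W)"
    proof
      assume "v \<in> perp (rad W)"
      moreover have "u - v \<in> perp (rad W)" using uv by (auto simp: rad_def perp_def)
      ultimately have "u - v + v \<in> perp (rad W)" using subspace_perp subspace_add by blast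
      then show False using u by simp
    qed
    then show "v \<in> ?A \<longleftrightarrow> u - v \<in> perp W" using uv v by simp
  qed (use subspace_perp in auto)
  have 2: "card ?A = card V - card (perp (rad W))"
    using perp_subset_V by (intro card_Diff_subset) auto
  have 3: "card (perp (rad W)) * card (rad W) = card V"
    using card_perp[OF subspace_rad[OF W(1)] rad_subset(3)] by (simp add: mult.commute)
  have 4: "card W * card (perp W) = card V" using card_perp[OF W] .
      have "card (invariants W ` ?A) * card (rad W) * card (perp W)
      = q * (card W * card (rad W) - card W) * card (perp W)"
  proof -
    have "card (invariants W ` ?A) * card (rad W) * card (perp W)
        = q * ((card (?r ` ?A) * card (perp W)) * card (rad W))"
      by (simp add: 0)
    also have "\<dots> = q * (card V * card (rad W) - card V)"
      unfolding 1 2 by (simp add: diff_mult_distrib 3)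
    also have "\<dots> = q * (card W * card (rad W) - card W) * card (perp W)"
      unfolding 4[symmetric] by (simp add: diff_mult_distrib diff_mult_distrib2 mult_ac)
    finally show ?thesis .
  qed
  moreover have "card (perp W) > 0"
    using subspace_0[OF subspace_perp] finite_perp card_gt_0_iff by blast
  ultimately show ?thesis by (metis mult_cancel2 less_irrefl)
qed

text \<open>Polarization: if all norms on \<open>perp W\<close> vanish, a nonzero pairing h y z can
  be scaled so that y + c z has norm x + x^q = 1. So all pairings vanish, and \<open>perp W\<close>
  lies in its complement \<open>W\<close>, hence in the radical.\<close>

lemma obtain_anisotropic:
  assumes W: "subspace W" "W \<subseteq> V" and card: "card (perp W) > card (rad W)"
  obtains y where "y \<in> perp W" "h y y \<noteq> 0"
proof -
  have "\<exists>y\<in>perp W. h y y \<noteq> 0"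
  proof (rule ccontr)
    assume "\<not> ?thesis"
    then have iso: "h y y = 0" if "y \<in> perp W" for y using that by blast
    have "h y z = 0" if yz: "y \<in> perp W" "z \<in> perp W" for y z
    proof (rule ccontr)
      assume t: "h y z \<noteq> 0"
      obtain x :: 'a where x: "x + x ^ q = 1" using obtain_trace[of 1] by auto
      define c where "c = x / h z y"
      have "h z y \<noteq> 0" using t form_swap_eq_0 by blast
      then have c: "c * h z y = x" by (simp add: c_def)
      then have c': "c ^ q * h y z = x ^ q"
        unfolding form_swap[of y z] by (simp flip: power_mult_distrib)
      have "h (y + c *\<^sub>V z) (y + c *\<^sub>V z) = h y y + c * h z y + c ^ q * h y z + c * c ^ q * h z z"
        by (simp add: form_simps algebra_simps)
      also have "\<dots> = 1" using iso yz c c' x by simp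
      finally show False
        using iso[of "y + c *\<^sub>V z"] yz subspace_perp by (simp add: subspace_add subspace_scale)
    qed
    then have "perp W \<subseteq> perp (perp W)" using perp_subset_V by (auto simp: perp_def[of "perp W"])
    then have "perp W \<subseteq> rad W" using perp_perp[OF W] by (auto simp: rad_def)
    then have "card (perp W) \<le> card (rad W)"
      using rad_subset(3) by (intro card_mono) auto
    then show False using card by simp
  qed
  then show ?thesis using that by blast
qed

lemma norms_perp:
  assumes W: "subspace W" "W \<subseteq> V" and card: "card (perp W) > card (rad W)"
  shows "(\<lambda>y. h y y) ` {y \<in> perp W. h y y \<noteq> 0} = fixed_field - {0}"
proof (intro equalityI subsetI)
  fix c assume c: "c \<in> fixed_field - {0}"
  obtain y where y: "y \<in> perp W" "h y y \<noteq> 0" using obtain_anisotropic[OF assms] .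
  have "(c / h y y) ^ q = c / h y y"
    using c form_self_in_fixed_field[of y] by (simp add: power_divide fixed_field_def)
  then obtain l where l: "l * l ^ q = c / h y y" by (rule obtain_norm)
  have "h (l *\<^sub>V y) (l *\<^sub>V y) = (l * l ^ q) * h y y" by (simp add: form_simps)
  then have "h (l *\<^sub>V y) (l *\<^sub>V y) = c" using l y by simp
  moreover have "l *\<^sub>V y \<in> perp W" using y subspace_perp by (simp add: subspace_scale)
  ultimately show "c \<in> (\<lambda>y. h y y) ` {y \<in> perp W. h y y \<noteq> 0}" using c by force
qed (auto simp: form_self_in_fixed_field)

text \<open>The hypothesis says that perp W / rad W has dimension at least 2. For anisotropic
  \<open>y\<close> and \<open>z\<close> outside \<open>W\<close> orthogonal to it, surjectivity of
  the norm map gives a multiple of \<open>y\<close> whose norm cancels that of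
  \<open>z\<close>.\<close>

lemma exists_isotropic:
  assumes W: "subspace W" "W \<subseteq> V" and card: "card (perp W) > CARD('a) * card (rad W)"
  shows "\<exists>y\<in>perp W - W. h y y = 0"
proof -
  have "card (rad W) \<le> CARD('a) * card (rad W)" using card_field_gt_1 by simp
  then obtain y where y: "y \<in> perp W" "h y y \<noteq> 0" using obtain_anisotropic[OF W] card by fastforce
  let ?K = "{x \<in> perp W. h x y = 0}"
  have "card (perp W) = CARD('a) * card ?K"
    using y by (intro card_kernel subspace_perp) auto
  then have "card ?K > card (rad W)" using card by simp
  then have "\<not> ?K \<subseteq> rad W" using card_mono[of "rad W" ?K] rad_subset(3) by auto
  then obtain z where z: "z \<in> perp W" "h z y = 0" "z \<notin> W" by (auto simp: rad_def)
  have "(- h z z / h y y) ^ q = - h z z / h y y"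
    using form_self_in_fixed_field[of y] form_self_in_fixed_field[of z]
    by (simp add: power_divide power_q_minus fixed_field_def)
  then obtain l where l: "l * l ^ q = - h z z / h y y" by (rule obtain_norm)
  let ?x = "l *\<^sub>V y + z"
  have "h y z = 0" using z form_swap_eq_0 by blast
  then have "h ?x ?x = (l * l ^ q) * h y y + h z z" using z by (simp add: form_simps)
  then have iso: "h ?x ?x = 0" using l y by simp
  have x: "?x \<in> perp W" using y z subspace_perp by (simp add: subspace_add subspace_scale)
  show ?thesis
  proof (cases "l = 0")
    case False
    have "h ?x y \<noteq> 0" using y z False by (simp add: form_simps)
    then have "?x \<notin> W" using y perpD by blast
    then show ?thesis using x iso by blast
  next
    case True
    then show ?thesis using z iso by auto
  qed
qed

lemma stab_span:
  assumes "S \<subseteq> V"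
  shows "stab (span S) = stab S"
proof
  show "stab S \<subseteq> stab (span S)"
  proof
    fix g assume g: "g \<in> stab S"
    then have gi: "g \<in> isometries" by (simp add: stab_def)
    have "subspace {v \<in> V. g v = v}" by (rule subspace_fixed_space[OF gi])
    moreover have "S \<subseteq> {v \<in> V. g v = v}" using g assms by (auto simp: stab_def)
    ultimately have "span S \<subseteq> {v \<in> V. g v = v}" by (rule span_minimal[rotated])
    then show "g \<in> stab (span S)" using gi by (auto simp: stab_def)
  qed
qed (auto simp: stab_def span_base)

section \<open>One-vector extensions sorted by the new radical\<close>

lemma card_power_field_eq_iff: "CARD('a) ^ i = CARD('a) ^ j \<longleftrightarrow> i = j"
  using card_field_gt_1 by (simp add: power_inject_exp)

definition extensions :: "nat \<Rightarrow> 'v set \<Rightarrow> 'v set" where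
  "extensions s W = {v \<in> V - W. card (rad (span (insert v W))) = CARD('a) ^ s}"

text \<open>Three disjoint parts cover \<open>V - W\<close> by \<open>perp_rad\<close>: a vector not
  orthogonal to the radical lowers its dimension by one, an anisotropic component in
  \<open>perp W\<close> keeps it, and an isotropic component outside \<open>W\<close> raises it by
  one.\<close>

lemma extensions_cases:
  assumes W: "subspace W" "W \<subseteq> V" and r: "card (rad W) = CARD('a) ^ r"
  shows "extensions s W =
    (if r = Suc s then V - perp (rad W)
     else if r = s then {w + y |w y. w \<in> W \<and> y \<in> {y \<in> perp W. h y y \<noteq> 0}}
     else if s = Suc r then {w + y |w y. w \<in> W \<and> y \<in> {y \<in> perp W - W. h y y = 0}}
     else {})"
proof -
  let ?A1 = "V - perp (rad W)"
  let ?A2 = "{w + y |w y. w \<in> W \<and> y \<in> {y \<in> perp W. h y y \<noteq> 0}}"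
  let ?A3 = "{w + y |w y. w \<in> W \<and> y \<in> {y \<in> perp W - W. h y y = 0}}"
  have notin: "w + y \<notin> W" if "w \<in> W" "y \<notin> W" for w y
    using that W by (metis add_diff_cancel_left' subspace_diff)
  have inV: "w + y \<in> V" if "w \<in> W" "y \<in> perp W" for w y
    using that W perp_subset_V subspace_V subspace_add by blast
  have Q: "CARD('a) * CARD('a) ^ i = CARD('a) ^ j \<longleftrightarrow> j = Suc i" for i j
    using card_power_field_eq_iff[of "Suc i" j] by auto
  have 1: "v \<in> V - W \<and> (\<forall>s. card (rad (span (insert v W))) = CARD('a) ^ s \<longleftrightarrow> r = Suc s)"
    if v: "v \<in> ?A1" for v
  proof -
    have "v \<notin> W" using v perpD(2) rad_subset(2) by (fastforce simp: perp_def[of "rad W"])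
    moreover have "CARD('a) ^ r = CARD('a) * card (rad (span (insert v W)))"
      using rad_span_insert_kernel[OF W, of v] v r by simp
    then have "card (rad (span (insert v W))) = CARD('a) ^ s \<longleftrightarrow> r = Suc s" for s
      using Q[of s r] card_field_gt_1 by auto
    ultimately show ?thesis using v by simp
  qed
  have 2: "v \<in> V - W \<and> (\<forall>s. card (rad (span (insert v W))) = CARD('a) ^ s \<longleftrightarrow> r = s)"
    if v: "v \<in> ?A2" for v
  proof -
    obtain w y where wy: "v = w + y" "w \<in> W" "y \<in> perp W" "h y y \<noteq> 0" using v by blast
    have "y \<notin> W" using wy perpD by blast
    then show ?thesis
      using wy notin inV card_rad_span_insert_perp[OF W wy(3)] r
      by (simp add: span_insert_add[OF W(1)] card_power_field_eq_iff)
  qed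
  have 3: "v \<in> V - W \<and> (\<forall>s. card (rad (span (insert v W))) = CARD('a) ^ s \<longleftrightarrow> s = Suc r)"
    if v: "v \<in> ?A3" for v
  proof -
    obtain w y where wy: "v = w + y" "w \<in> W" "y \<in> perp W" "y \<notin> W" "h y y = 0" using v by blast
    then show ?thesis
      using notin inV card_rad_span_insert_perp[OF W wy(3)] r Q
      by (simp add: span_insert_add[OF W(1)])
  qed
  have cover: "v \<in> ?A1 \<or> v \<in> ?A2 \<or> v \<in> ?A3" if "v \<in> V - W" for v
  proof (cases "v \<in> perp (rad W)")
    case True
    then obtain w y where wy: "v = w + y" "w \<in> W" "y \<in> perp W" using perp_rad[OF W] by blast
    then have "y \<notin> W" using that W by (auto simp: subspace_add)
    then show ?thesis using wy by blast
  qed (use that in blast)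
  have eq: "extensions s W = {v. v \<in> ?A1 \<and> r = Suc s \<or> v \<in> ?A2 \<and> r = s \<or> v \<in> ?A3 \<and> s = Suc r}"
    (is "_ = ?R")
  proof (intro equalityI subsetI)
    fix v assume "v \<in> extensions s W"
    then have v: "v \<in> V - W" "card (rad (span (insert v W))) = CARD('a) ^ s"
      by (auto simp: extensions_def)
    show "v \<in> ?R"
      using cover[OF v(1)] 1[of v] 2[of v] 3[of v] v(2) unfolding mem_Collect_eq by metis
  next
    fix v assume "v \<in> ?R"
    then show "v \<in> extensions s W"
      unfolding extensions_def using 1[of v] 2[of v] 3[of v] unfolding mem_Collect_eq by metis
  qed
  show ?thesis unfolding eq by auto
qed

text \<open>The new radical, of order Q^s, lies in the complement of the new span, of order Q^(n - d
  - 1).\<close>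

lemma extensions_dim_le:
  assumes W: "subspace W" "W \<subseteq> V" "card W = CARD('a) ^ d" and ne: "extensions s W \<noteq> {}"
  shows "d + 1 + s \<le> n"
proof -
  obtain v where v: "v \<in> V" "v \<notin> W" "card (rad (span (insert v W))) = CARD('a) ^ s"
    using ne by (auto simp: extensions_def)
  let ?W = "span (insert v W)"
  have sub: "?W \<subseteq> V" using W v subspace_V by (intro span_minimal) auto
  have c: "card ?W = CARD('a) ^ (d + 1)"
    using card_span_insert[OF W(1) _ v(2)] W by simp
  have "CARD('a) ^ s \<le> card (perp ?W)"
    using v(3) rad_subset(2)[of ?W] card_mono[OF finite_perp] by metis
  then have "CARD('a) ^ (d + 1) * CARD('a) ^ s \<le> card ?W * card (perp ?W)" unfolding c by simp
  also have "\<dots> = CARD('a) ^ n" using card_perp[OF subspace_span sub] card_V by simp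
  finally have "CARD('a) ^ (d + 1 + s) \<le> CARD('a) ^ n" by (simp only: power_add)
  then show ?thesis using power_le_imp_le_exp[OF card_field_gt_1] by blast
qed

text \<open>The three terms are the three possible positions of the new vector relative to the radical.\<close>
lemma card_invariants_extensions:
  assumes W: "subspace W" "W \<subseteq> V" "card W = CARD('a) ^ d" and r: "card (rad W) = CARD('a) ^ r"
  shows "real (card (invariants W ` extensions s W)) =
    of_bool (r = Suc s) * (real q * (real q ^ (2 * d) - real q ^ (2 * d) / real q ^ (2 * Suc s)))
    + of_bool (d + 1 + s \<le> n) * (of_bool (r = s) * ((real q - 1) * (real q ^ (2 * d) / real q ^ (2 * s)))
       + of_bool (Suc r = s) * (real q ^ (2 * d) / real q ^ (2 * r)))"
proof -
  have pw: "real (CARD('a) ^ i) = real q ^ (2 * i)" for i by (simp add: card_field power_mult)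
  have q0: "real q > 0" using q_gt_1 by simp
  have cp: "CARD('a) ^ d * card (perp W) = CARD('a) ^ n" using card_perp[OF W(1,2)] W(3) card_V by simp
  \<comment> \<open>Since \<open>perp W\<close> has order Q^(n - d), the bound d + 1 + s <= n gives
    the size condition of \<open>norms_perp\<close> for s = r and of \<open>exists_isotropic\<close>
    for s = r + 1. If it fails, there are no extensions.\<close>
  have cp': "card (perp W) > CARD('a) ^ i" if "d + i < n" for i
  proof -
    have "CARD('a) ^ d * CARD('a) ^ i < CARD('a) ^ d * card (perp W)"
      unfolding cp power_add[symmetric] using that card_field_gt_1 by simp
    then show ?thesis by simp
  qed
  have translates: "real (card (invariants W ` {w + y |w y. w \<in> W \<and> y \<in> Y}))
      = real q ^ (2 * d) / real q ^ (2 * r) * real (card ((\<lambda>y. h y y) ` Y))" if "Y \<subseteq> perp W" for Y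
  proof -
    have "real (card (invariants W ` {w + y |w y. w \<in> W \<and> y \<in> Y})) * real (card (rad W))
      = real (card W) * real (card ((\<lambda>y. h y y) ` Y))"
      unfolding of_nat_mult[symmetric] card_invariants_perp_translates[OF W(1,2) that] ..
    then show ?thesis using q0 unfolding r W(3) pw by (simp add: field_simps)
  qed
  consider "r = Suc s" | "r = s" | "Suc r = s" | "r \<noteq> Suc s" "r \<noteq> s" "Suc r \<noteq> s" by blast
  then show ?thesis
  proof cases
    case 1
    \<comment> \<open>Here d + 1 + s <= n holds automatically: \<open>rad W\<close> has order Q^(s +
      1) and lies in \<open>perp W\<close>, of order Q^(n - d).\<close>
    let ?A = "V - perp (rad W)"
    have "real (card (invariants W ` ?A) * card (rad W)) = real (q * (card W * card (rad W) - card W))"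
      using card_invariants_generic[OF W(1,2)] by simp
    moreover have "card W \<le> card W * card (rad W)" using r card_field_gt_1 by simp
    ultimately have "real (card (invariants W ` ?A)) * real (card (rad W))
        = real q * (real (card W) * real (card (rad W)) - real (card W))"
      by (simp add: of_nat_diff)
    then show ?thesis
      using 1 q0 unfolding extensions_cases[OF W(1,2) r] r W(3) pw by (simp add: field_simps)
  next
    case 2
    let ?Y = "{y \<in> perp W. h y y \<noteq> 0}"
    have ext: "extensions s W = {w + y |w y. w \<in> W \<and> y \<in> ?Y}"
      using extensions_cases[OF W(1,2) r, of s] 2 by simp
    show ?thesis
    proof (cases "d + 1 + s \<le> n")
      case True
      have "card ((\<lambda>y. h y y) ` ?Y) = q - 1"
        using norms_perp[OF W(1,2)] cp'[of r] True 2 r card_fixed_field q_gt_1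
        by (simp add: fixed_field_def)
      then show ?thesis
        unfolding ext using translates[of ?Y] 2 True q_gt_1 by (simp add: of_nat_diff)
    next
      case False
      then have "extensions s W = {}" using extensions_dim_le[OF W] by blast
      then show ?thesis using False 2 by simp
    qed
  next
    case 3
    let ?Y = "{y \<in> perp W - W. h y y = 0}"
    have ext: "extensions s W = {w + y |w y. w \<in> W \<and> y \<in> ?Y}"
      using extensions_cases[OF W(1,2) r, of s] 3 by auto
    show ?thesis
    proof (cases "d + 1 + s \<le> n")
      case True
      have "\<exists>y\<in>perp W - W. h y y = 0"
        using cp'[of "Suc r"] True by (intro exists_isotropic W) (simp add: r 3[symmetric])
      then have "(\<lambda>y. h y y) ` ?Y = {0}" by auto
      then show ?thesis
        unfolding ext using translates[of ?Y] 3 True by auto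
    next
      case False
      then have "extensions s W = {}" using extensions_dim_le[OF W] by blast
      then show ?thesis using False 3 by auto
    qed
  next
    case 4
    then have "extensions s W = {}" using extensions_cases[OF W(1,2) r, of s] by auto
    then show ?thesis using 4 by simp
  qed
qed

text \<open>By \<open>extensions_cases\<close> it suffices that an isometry fixing \<open>W\<close>
  preserves \<open>perp W\<close>, norms, pairings with the radical and, by injectivity, the
  complement of \<open>W\<close>.\<close>

lemma extensions_closed:
  assumes W: "subspace W" "W \<subseteq> V" and g: "g \<in> stab W" and v: "v \<in> extensions s W"
  shows "g v \<in> extensions s W"
proof -
  have gi: "g \<in> isometries" and fix_W: "\<And>w. w \<in> W \<Longrightarrow> g w = w" using g by (auto simp: stab_def)
  have perp_closed: "g y \<in> perp W" if "y \<in> perp W" for y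
  proof -
    have "h (g y) w = 0" if "w \<in> W" for w
      using isometriesD(4)[OF gi, of y w] fix_W that \<open>y \<in> perp W\<close> W perp_subset_V
      by (auto simp: perpD)
    then show ?thesis using isometriesD(1)[OF gi] that perp_subset_V by (auto simp: perp_def)
  qed
  have notin_W: "g y \<notin> W" if "y \<in> V" "y \<notin> W" for y
  proof
    assume "g y \<in> W"
    moreover from this have "g (g y) = g y" by (rule fix_W)
    moreover have "g y \<in> V" using isometriesD(1)[OF gi that(1)] .
    ultimately have "g y = y" using inj_onD[OF isometry_inj[OF gi]] that(1) by blast
    then show False using \<open>g y \<in> W\<close> that(2) by simp
  qed
  have add: "g (w + y) = w + g y" if "w \<in> W" "y \<in> perp W" for w y
    using isometriesD(2)[OF gi, of w y] that W perp_subset_V fix_W by auto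
  have norm: "h (g y) (g y) = h y y" if "y \<in> perp W" for y
    using isometriesD(4)[OF gi, of y y] that perp_subset_V by blast
  obtain r where r: "card (rad W) = CARD('a) ^ r"
    using card_subspace_power[OF subspace_rad[OF W(1)] rad_subset(3)] by blast
  have rad_closed: "g v \<in> V - perp (rad W)" if v: "v \<in> V - perp (rad W)" for v
  proof -
    obtain x where x: "x \<in> rad W" "h v x \<noteq> 0" using v by (auto simp: perp_def)
    have "x \<in> W" "x \<in> V" using x rad_subset W by blast+
    then have "h (g v) x = h v x" using isometriesD(4)[OF gi, of v x] fix_W v by simp
    then have "g v \<notin> perp (rad W)" using x perpD(1) by auto
    then show ?thesis using isometriesD(1)[OF gi] v by auto
  qed
  have Y2: "g v \<in> {w + y |w y. w \<in> W \<and> y \<in> {y \<in> perp W. h y y \<noteq> 0}}"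
    if v: "v \<in> {w + y |w y. w \<in> W \<and> y \<in> {y \<in> perp W. h y y \<noteq> 0}}" for v
  proof -
    obtain w y where "v = w + y" "w \<in> W" "y \<in> perp W" "h y y \<noteq> 0" using v by blast
    then have "g v = w + g y" "g y \<in> perp W" "h (g y) (g y) \<noteq> 0"
      using add perp_closed norm by auto
    then show ?thesis using \<open>w \<in> W\<close> by blast
  qed
  have Y3: "g v \<in> {w + y |w y. w \<in> W \<and> y \<in> {y \<in> perp W - W. h y y = 0}}"
    if v: "v \<in> {w + y |w y. w \<in> W \<and> y \<in> {y \<in> perp W - W. h y y = 0}}" for v
  proof -
    obtain w y where "v = w + y" "w \<in> W" "y \<in> perp W" "y \<notin> W" "h y y = 0" using v by blast
    moreover from this have "y \<in> V" using perp_subset_V by blast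
    ultimately have "g v = w + g y" "g y \<in> perp W" "g y \<notin> W" "h (g y) (g y) = 0"
      using add perp_closed norm notin_W by auto
    then show ?thesis using \<open>w \<in> W\<close> by blast
  qed
  show ?thesis
    using v rad_closed Y2 Y3 unfolding extensions_cases[OF W r]
    by (simp only: split: if_splits) blast+
qed

end

section \<open>Moments in terms of independent lists\<close>

context hermitian_space
begin

fun indep_list :: "'v list \<Rightarrow> bool" where
  "indep_list [] \<longleftrightarrow> True"
| "indep_list (v # vs) \<longleftrightarrow> v \<in> V \<and> v \<notin> span (set vs) \<and> indep_list vs"

definition indep_lists :: "nat \<Rightarrow> 'v list set" where
  "indep_lists d = {vs. length vs = d \<and> indep_list vs}"

lemma indep_list_subset_V: "indep_list vs \<Longrightarrow> set vs \<subseteq> V"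
  by (induction vs) auto

lemma span_subset_V: "S \<subseteq> V \<Longrightarrow> span S \<subseteq> V"
  by (intro span_minimal subspace_V)

lemma span_insert_span: "span (insert v (span S)) = span (insert v S)"
proof (rule span_eq[THEN iffD2], intro conjI)
  show "insert v (span S) \<subseteq> span (insert v S)"
    using span_mono[of S "insert v S"] by (auto intro: span_base)
  show "insert v S \<subseteq> span (insert v (span S))"
    by (auto intro!: span_base)
qed

lemma card_span_indep_list: "indep_list vs \<Longrightarrow> card (span (set vs)) = CARD('a) ^ length vs"
proof (induction vs)
  case (Cons v vs)
  have "finite (span (set vs))"
    using indep_list_subset_V[of vs] Cons.prems span_subset_V by simp
  then have "card (span (insert v (span (set vs)))) = CARD('a) * card (span (set vs))"
    using Cons.prems by (intro card_span_insert) auto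
  then show ?case using Cons by (simp add: span_insert_span)
qed simp

lemma finite_indep_lists [simp]: "finite (indep_lists d)"
  by (rule finite_subset[OF _ finite_lists_length_eq[OF finite_V, of d]])
    (use indep_list_subset_V in \<open>auto simp: indep_lists_def\<close>)

lemma indep_lists_0: "indep_lists 0 = {[]}"
  by (auto simp: indep_lists_def)

lemma sum_indep_lists_Suc:
  fixes f :: "'v list \<Rightarrow> 'b::comm_monoid_add"
  shows "(\<Sum>vs\<in>indep_lists (Suc d). f vs)
    = (\<Sum>vs\<in>indep_lists d. \<Sum>v\<in>V - span (set vs). f (v # vs))"
proof -
  have "(\<Sum>vs\<in>indep_lists d. \<Sum>v\<in>V - span (set vs). f (v # vs))
      = (\<Sum>(vs, v)\<in>Sigma (indep_lists d) (\<lambda>vs. V - span (set vs)). f (v # vs))"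
    by (intro sum.Sigma) auto
  also have "\<dots> = (\<Sum>vs\<in>indep_lists (Suc d). f vs)"
    by (rule sum.reindex_bij_witness[of _ "\<lambda>vs. (tl vs, hd vs)" "\<lambda>(vs, v). v # vs"])
      (auto simp: indep_lists_def length_Suc_conv)
  finally show ?thesis ..
qed

lemma card_indep_lists_in_subspace:
  assumes "subspace U" "U \<subseteq> V"
  shows "real (card {vs \<in> indep_lists d. set vs \<subseteq> U}) = (\<Prod>i<d. real (card U) - real q ^ (2 * i))"
proof (induction d)
  case 0
  have "{vs \<in> indep_lists 0. set vs \<subseteq> U} = {[]}" by (auto simp: indep_lists_0)
  then show ?case by simp
next
  case (Suc d)
  have "real (card {vs \<in> indep_lists (Suc d). set vs \<subseteq> U})
      = (\<Sum>vs\<in>indep_lists (Suc d). of_bool (set vs \<subseteq> U))"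
    by (simp add: of_bool_def sum.If_cases Int_def)
  also have "\<dots> = (\<Sum>vs\<in>indep_lists d. \<Sum>v\<in>V - span (set vs). of_bool (set (v # vs) \<subseteq> U))"
    by (rule sum_indep_lists_Suc)
  also have "\<dots> = (\<Sum>vs\<in>indep_lists d. of_bool (set vs \<subseteq> U) * (real (card U) - real q ^ (2 * d)))"
  proof (rule sum.cong[OF refl])
    fix vs assume vs: "vs \<in> indep_lists d"
    show "(\<Sum>v\<in>V - span (set vs). of_bool (set (v # vs) \<subseteq> U))
      = of_bool (set vs \<subseteq> U) * (real (card U) - real q ^ (2 * d))"
    proof (cases "set vs \<subseteq> U")
      case True
      then have sub: "span (set vs) \<subseteq> U" using assms by (intro span_minimal)
      have "(\<Sum>v\<in>V - span (set vs). of_bool (set (v # vs) \<subseteq> U))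
          = real (card ((V - span (set vs)) \<inter> U))"
        using True by (simp add: of_bool_def sum.If_cases Int_def)
      also have "(V - span (set vs)) \<inter> U = U - span (set vs)" using assms by blast
      also have "card (U - span (set vs)) = card U - card (span (set vs))"
        using sub assms by (intro card_Diff_subset) (auto intro: finite_subset)
      also have "real \<dots> = real (card U) - real (card (span (set vs)))"
        using sub assms by (intro of_nat_diff card_mono) auto
      finally show ?thesis
        using True vs card_span_indep_list[of vs] by (simp add: indep_lists_def card_field power_mult)
    qed simp
  qed
  also have "\<dots> = real (card {vs \<in> indep_lists d. set vs \<subseteq> U}) * (real (card U) - real q ^ (2 * d))"
    by (simp add: of_bool_def sum.If_cases Int_def flip: sum_distrib_right)
  finally show ?case using Suc by simp
qed

text \<open>By orbit-stabilizer this is \<open>card isometries\<close> times the number of orbits on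
  independent \<open>d\<close>-lists whose span has a radical of order Q^s. In this unnormalized
  form \<open>sum_card_stab\<close> applies inside the sum.\<close>

definition stab_sum :: "nat \<Rightarrow> nat \<Rightarrow> real" where
  "stab_sum d s = (\<Sum>vs\<in>indep_lists d.
     of_bool (card (rad (span (set vs))) = CARD('a) ^ s) * real (card (stab (set vs))))"

lemma stab_sum_0: "stab_sum 0 s = of_bool (s = 0) * real (card isometries)"
proof -
  have "rad {0} = {0}" using subspace_0[OF subspace_perp] by (auto simp: rad_def)
  moreover have "stab {} = isometries" by (simp add: stab_def)
  moreover have "Suc 0 = CARD('a) ^ s \<longleftrightarrow> s = 0" using card_power_field_eq_iff[of 0 s] by auto
  ultimately show ?thesis by (simp add: stab_sum_def indep_lists_0)
qed

text \<open>Summation over the new head gives \<open>card (stab (set vs))\<close> times a number of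
  invariants that depends only on d, s and the old radical, so the recursion closes. The factor
  \<open>of_bool (s > 0)\<close> guards the truncated \<open>s - 1\<close>.\<close>

lemma stab_sum_Suc:
  "stab_sum (Suc d) s =
    real q * (real q ^ (2 * d) - real q ^ (2 * d) / real q ^ (2 * Suc s)) * stab_sum d (Suc s)
    + of_bool (d + 1 + s \<le> n) * ((real q - 1) * (real q ^ (2 * d) / real q ^ (2 * s)) * stab_sum d s
       + of_bool (s > 0) * (real q ^ (2 * d) / real q ^ (2 * (s - 1)) * stab_sum d (s - 1)))"
  (is "_ = ?a * stab_sum d (Suc s) + ?t * (?b * stab_sum d s + ?u * (?c * stab_sum d (s - 1)))")
proof -
  let ?r = "\<lambda>vs s. of_bool (card (rad (span (set vs))) = CARD('a) ^ s) :: real"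
  have "stab_sum (Suc d) s = (\<Sum>vs\<in>indep_lists d. \<Sum>v\<in>V - span (set vs). ?r (v # vs) s * real (card (stab (set (v # vs)))))"
    unfolding stab_sum_def by (rule sum_indep_lists_Suc)
  also have "\<dots> = (\<Sum>vs\<in>indep_lists d. real (card (stab (set vs))) *
      (?a * ?r vs (Suc s) + ?t * (?b * ?r vs s + ?u * (?c * ?r vs (s - 1)))))"
  proof (rule sum.cong[OF refl])
    fix vs assume "vs \<in> indep_lists d"
    then have vs: "indep_list vs" "length vs = d" by (auto simp: indep_lists_def)
    let ?W = "span (set vs)"
    have W: "subspace ?W" "?W \<subseteq> V" "card ?W = CARD('a) ^ d"
      using vs card_span_indep_list indep_list_subset_V span_subset_V by auto
    obtain r where r: "card (rad ?W) = CARD('a) ^ r"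
      using card_subspace_power[OF subspace_rad[OF W(1)] rad_subset(3)] by blast
    have stab_eq: "stab (insert v ?W) = stab (insert v (set vs))" if "v \<in> V" for v
      using that vs(1) indep_list_subset_V stab_span[of "set vs"] by (auto simp: stab_def)
    have "(\<Sum>v\<in>V - ?W. ?r (v # vs) s * real (card (stab (set (v # vs)))))
        = (\<Sum>v\<in>V - ?W. if v \<in> extensions s ?W then real (card (stab (insert v ?W))) else 0)"
      by (rule sum.cong) (auto simp: extensions_def span_insert_span stab_eq)
    also have "\<dots> = (\<Sum>v\<in>extensions s ?W. real (card (stab (insert v ?W))))"
      by (subst sum.inter_restrict[symmetric]) (auto simp: extensions_def intro!: sum.cong)
    also have "\<dots> = real (card (stab ?W)) * real (card (invariants ?W ` extensions s ?W))"
      unfolding of_nat_sum[symmetric] of_nat_mult[symmetric] of_nat_eq_iff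
      by (rule sum_card_stab[OF W(1,2)], force simp: extensions_def, rule extensions_closed[OF W(1,2)])
    also have "real (card (invariants ?W ` extensions s ?W))
        = ?a * ?r vs (Suc s) + ?t * (?b * ?r vs s + ?u * (?c * ?r vs (s - 1)))"
      unfolding card_invariants_extensions[OF W r] r card_power_field_eq_iff
      by (cases s) (auto simp: of_bool_def)
    also have "stab ?W = stab (set vs)"
      using vs(1) indep_list_subset_V stab_span by blast
    finally show "(\<Sum>v\<in>V - ?W. ?r (v # vs) s * real (card (stab (set (v # vs)))))
        = real (card (stab (set vs))) * (?a * ?r vs (Suc s) + ?t * (?b * ?r vs s + ?u * (?c * ?r vs (s - 1))))" .
  qed
  also have "\<dots> = ?a * stab_sum d (Suc s) + ?t * (?b * stab_sum d s + ?u * (?c * stab_sum d (s - 1)))"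
    unfolding stab_sum_def sum_distrib_left sum.distrib[symmetric]
    by (rule sum.cong[OF refl]) (simp only: distrib_left mult_ac)
  finally show ?thesis .
qed

lemma indep_lists_rad:
  assumes "vs \<in> indep_lists d"
  shows "\<exists>!s. s \<le> d \<and> card (rad (span (set vs))) = CARD('a) ^ s"
proof -
  let ?W = "span (set vs)"
  have W: "subspace ?W" "?W \<subseteq> V" "card ?W = CARD('a) ^ d"
    using assms card_span_indep_list indep_list_subset_V span_subset_V
    by (auto simp: indep_lists_def)
  obtain r where r: "card (rad ?W) = CARD('a) ^ r"
    using card_subspace_power[OF subspace_rad[OF W(1)] rad_subset(3)] by blast
  have "card (rad ?W) \<le> card ?W"
    using W rad_subset(1) finite_subset_V by (intro card_mono) auto
  then have "r \<le> d" using r W(3) power_le_imp_le_exp[OF card_field_gt_1] by simp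
  then show ?thesis using r card_power_field_eq_iff by auto
qed

text \<open>Double counting of pairs of an isometry and an independent list of fixed vectors.\<close>
lemma sum_fixed_space_moments:
  "(\<Sum>g\<in>isometries. \<Prod>i<d. real (card {v \<in> V. g v = v}) - real q ^ (2 * i)) = (\<Sum>s\<le>d. stab_sum d s)"
proof -
  have "(\<Sum>g\<in>isometries. \<Prod>i<d. real (card {v \<in> V. g v = v}) - real q ^ (2 * i))
      = (\<Sum>g\<in>isometries. real (card {vs \<in> indep_lists d. set vs \<subseteq> {v \<in> V. g v = v}}))"
    by (rule sum.cong[OF refl], rule card_indep_lists_in_subspace[symmetric]) (auto simp: subspace_fixed_space)
  also have "\<dots> = (\<Sum>g\<in>isometries. \<Sum>vs\<in>indep_lists d. of_bool (g \<in> stab (set vs)))"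
  proof (rule sum.cong[OF refl])
    fix g assume g: "g \<in> isometries"
    have "{vs \<in> indep_lists d. set vs \<subseteq> {v \<in> V. g v = v}} = indep_lists d \<inter> {vs. g \<in> stab (set vs)}"
      using g indep_list_subset_V by (auto simp: stab_def indep_lists_def)
    then show "real (card {vs \<in> indep_lists d. set vs \<subseteq> {v \<in> V. g v = v}})
        = (\<Sum>vs\<in>indep_lists d. of_bool (g \<in> stab (set vs)))"
      by (simp add: of_bool_def sum.If_cases)
  qed
  also have "\<dots> = (\<Sum>vs\<in>indep_lists d. \<Sum>g\<in>isometries. of_bool (g \<in> stab (set vs)))"
    by (rule sum.swap)
  also have "\<dots> = (\<Sum>vs\<in>indep_lists d. real (card (stab (set vs))))"
  proof (rule sum.cong[OF refl])
    fix vs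
    have "isometries \<inter> {g. g \<in> stab (set vs)} = stab (set vs)" by (auto simp: stab_def)
    then show "(\<Sum>g\<in>isometries. of_bool (g \<in> stab (set vs))) = real (card (stab (set vs)))"
      by (simp add: of_bool_def sum.If_cases)
  qed
  also have "\<dots> = (\<Sum>vs\<in>indep_lists d. \<Sum>s\<le>d.
      of_bool (card (rad (span (set vs))) = CARD('a) ^ s) * real (card (stab (set vs))))"
  proof (rule sum.cong[OF refl])
    fix vs assume vs: "vs \<in> indep_lists d"
    obtain s where s: "s \<le> d" "card (rad (span (set vs))) = CARD('a) ^ s"
      using indep_lists_rad[OF vs] by blast
    show "real (card (stab (set vs))) = (\<Sum>s\<le>d.
      of_bool (card (rad (span (set vs))) = CARD('a) ^ s) * real (card (stab (set vs))))"
      using s by (simp add: card_power_field_eq_iff of_bool_def mult_delta_left)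
  qed
  also have "\<dots> = (\<Sum>s\<le>d. stab_sum d s)"
    unfolding stab_sum_def by (rule sum.swap)
  finally show ?thesis .
qed

end

section \<open>The Newton basis at powers of \<open>b\<close>\<close>

definition newton :: "real \<Rightarrow> nat \<Rightarrow> real \<Rightarrow> real" where
  "newton b j y = (\<Prod>i<j. y - b ^ i)"

text \<open>
  The coefficient of \<open>newton b (d + s)\<close> in the product of the \<open>y\<^sup>2 - b ^ (2 * i)\<close>, \<open>i < d\<close>, where \<open>d = s + t\<close>.
  For \<open>b = - q\<close>, up to the sign \<open>(- 1) ^ t\<close>, it is also the number of Hermitian \<open>d \<times> d\<close> matrices of corank \<open>s\<close>.
\<close>
definition beta_coeff :: "real \<Rightarrow> nat \<Rightarrow> nat \<Rightarrow> real" where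
  "beta_coeff b s t = b ^ (t choose 2) * (\<Prod>j<s + t. b ^ (2 * Suc j) - 1)
     / ((\<Prod>j<s. b ^ (2 * Suc j) - 1) * (\<Prod>j<t. b ^ Suc j - 1))"

lemma power_neq_1:
  assumes "\<bar>b\<bar> > (1 :: real)" "k > 0"
  shows "b ^ k \<noteq> 1"
proof
  assume "b ^ k = 1"
  then have "\<bar>b\<bar> ^ k = 1" by (metis abs_one power_abs)
  then show False using one_less_power[OF assms] by simp
qed

section \<open>Two recursions for the coefficients\<close>

context
  fixes b :: real
  assumes b: "\<bar>b\<bar> > 1"
begin

lemma b_nonzero: "b \<noteq> 0" using b by auto

lemma power_Suc_neq_1: "b ^ Suc j - 1 \<noteq> 0" "b ^ (2 * Suc j) - 1 \<noteq> 0" "b * b ^ j \<noteq> 1" "b * b ^ j - 1 \<noteq> 0"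
  using power_neq_1[OF b, of "Suc j"] power_neq_1[OF b, of "2 * Suc j"] by auto

lemma beta_coeff_0_right [simp]: "beta_coeff b s 0 = 1"
  using power_Suc_neq_1 by (simp add: beta_coeff_def binomial_eq_0)

lemma beta_coeff_nonzero: "beta_coeff b s t \<noteq> 0"
  using power_Suc_neq_1 b_nonzero by (simp add: beta_coeff_def)

lemma beta_coeff_Suc_right:
  "beta_coeff b s (Suc t) = b ^ t * (b ^ (2 * (s + Suc t)) - 1) / (b ^ Suc t - 1) * beta_coeff b s t"
proof -
  have "Suc t choose 2 = t + (t choose 2)" by (simp add: numeral_2_eq_2)
  then show ?thesis by (simp add: beta_coeff_def power_add field_simps)
qed

lemma beta_coeff_shift:
  "beta_coeff b s (Suc t) * (b ^ Suc t - 1) = b ^ t * (b ^ (2 * Suc s) - 1) * beta_coeff b (Suc s) t"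
proof -
  have "Suc t choose 2 = t + (t choose 2)" by (simp add: numeral_2_eq_2)
  then show ?thesis
    using power_Suc_neq_1(1)[of t] power_Suc_neq_1(2)[of s]
    by (simp add: beta_coeff_def power_add)
qed

text \<open>Both sides vanish at t = 0, as those of \<open>beta_coeff_raise\<close> do at s = 0, so
  the recursions need no boundary cases. The factor on the left is not divided out because it
  reappears in both recursions.\<close>

lemma beta_coeff_lower:
  "of_bool (t > 0) * beta_coeff b (Suc s) (t - 1) * (b\<^sup>2 * (b ^ s)\<^sup>2 - 1) * b ^ t
    = b * (b ^ t - 1) * beta_coeff b s t"
proof (cases t)
  case (Suc u)
  have "beta_coeff b (Suc s) u * (b\<^sup>2 * (b ^ s)\<^sup>2 - 1) * b ^ Suc u
      = b * (b ^ u * (b ^ (2 * Suc s) - 1) * beta_coeff b (Suc s) u)"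
    by (simp add: power_even_eq power_mult_distrib power2_eq_square)
  also have "\<dots> = b * (beta_coeff b s (Suc u) * (b ^ Suc u - 1))"
    by (simp only: beta_coeff_shift[symmetric])
  finally show ?thesis by (simp add: Suc mult_ac)
qed simp

lemma beta_coeff_raise:
  "of_bool (s > 0) * beta_coeff b (s - 1) (Suc t)
    = b ^ t * ((b ^ s)\<^sup>2 - 1) / (b * b ^ t - 1) * beta_coeff b s t"
proof (cases s)
  case (Suc r)
  have "beta_coeff b r (Suc t) * (b * b ^ t - 1) = b ^ t * ((b ^ s)\<^sup>2 - 1) * beta_coeff b s t"
    using beta_coeff_shift[of r t] by (simp only: power_even_eq Suc power_Suc)
  then show ?thesis using power_Suc_neq_1(4)[of t] Suc by (simp add: field_simps)
qed simp

lemma beta_coeff_Suc_right':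
  "beta_coeff b s (Suc t)
    = b ^ t * (b\<^sup>2 * (b ^ t)\<^sup>2 * (b ^ s)\<^sup>2 - 1) / (b * b ^ t - 1) * beta_coeff b s t"
  unfolding beta_coeff_Suc_right power_even_eq power_add power_Suc power_mult_distrib
  by (simp add: mult_ac)

text \<open>Comparison of the coefficients of \<open>newton b (d + 1 + s)\<close> when the factor
  y^2 - b^(2d), d = s + t, is multiplied in. All terms are rational multiples of
  \<open>beta_coeff b s t\<close>, which leaves a rational identity in X = b^t and Y = b^s.\<close>

lemma newton_coeff_recursion:
  "beta_coeff b s (Suc t) = of_bool (s > 0) * beta_coeff b (s - 1) (Suc t)
    + b ^ (s + t + s) * (1 + b) * beta_coeff b s t
    + of_bool (t > 0) * (b ^ (2 * (s + t + Suc s)) - b ^ (2 * (s + t))) * beta_coeff b (Suc s) (t - 1)"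
proof -
  define X Y K T where "X = b ^ t" and "Y = b ^ s" and "K = beta_coeff b s t"
    and "T = of_bool (t > 0) * beta_coeff b (Suc s) (t - 1)"
  have nz: "b * X - 1 \<noteq> 0" "X \<noteq> 0" using power_Suc_neq_1(4)[of t] b_nonzero by (auto simp: X_def)
  have T: "T * (b\<^sup>2 * Y\<^sup>2 - 1) * X = b * (X - 1) * K"
    unfolding T_def X_def Y_def K_def by (rule beta_coeff_lower)
  have "(b ^ (2 * (s + t + Suc s)) - b ^ (2 * (s + t))) = Y\<^sup>2 * X * ((b\<^sup>2 * Y\<^sup>2 - 1) * X)"
    unfolding power_even_eq power_add power_Suc X_def Y_def
    by (simp add: power2_eq_square algebra_simps)
  then have "of_bool (t > 0) * (b ^ (2 * (s + t + Suc s)) - b ^ (2 * (s + t))) * beta_coeff b (Suc s) (t - 1)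
      = Y\<^sup>2 * X * (T * (b\<^sup>2 * Y\<^sup>2 - 1) * X)"
    by (simp add: T_def mult_ac)
  then have 3: "of_bool (t > 0) * (b ^ (2 * (s + t + Suc s)) - b ^ (2 * (s + t))) * beta_coeff b (Suc s) (t - 1)
      = Y\<^sup>2 * X * (b * (X - 1) * K)"
    unfolding T .
  have 2: "b ^ (s + t + s) = Y\<^sup>2 * X" by (simp add: X_def Y_def power_add power2_eq_square)
  have "X * (b\<^sup>2 * X\<^sup>2 * Y\<^sup>2 - 1) / (b * X - 1)
      = X * (Y\<^sup>2 - 1) / (b * X - 1) + Y\<^sup>2 * X * (1 + b) + Y\<^sup>2 * X * (b * (X - 1))"
    using nz by (simp add: divide_simps) (simp add: power2_eq_square algebra_simps)
  then have "X * (b\<^sup>2 * X\<^sup>2 * Y\<^sup>2 - 1) / (b * X - 1) * K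
      = (X * (Y\<^sup>2 - 1) / (b * X - 1) + Y\<^sup>2 * X * (1 + b) + Y\<^sup>2 * X * (b * (X - 1))) * K"
    by (rule arg_cong)
  then show ?thesis
    unfolding 2 3 beta_coeff_raise beta_coeff_Suc_right'[of s t] X_def[symmetric] Y_def[symmetric] K_def[symmetric]
    by (simp only: distrib_right mult.assoc)
qed

text \<open>This is \<open>stab_sum_Suc\<close> at b = -q without the dimension bound and the group
  order: q and q - 1 become -b and -b - 1, and even powers do not see the sign.\<close>

lemma gram_coeff_recursion:
  "(- 1) ^ Suc t * beta_coeff b s (Suc t)
    = - b * (b ^ (2 * (s + t)) - b ^ (2 * (s + t)) / b ^ (2 * Suc s))
        * (of_bool (t > 0) * ((- 1) ^ (t - 1) * beta_coeff b (Suc s) (t - 1)))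
    + (- b - 1) * (b ^ (2 * (s + t)) / b ^ (2 * s)) * ((- 1) ^ t * beta_coeff b s t)
    + of_bool (s > 0) * (b ^ (2 * (s + t)) / b ^ (2 * (s - 1)) * ((- 1) ^ Suc t * beta_coeff b (s - 1) (Suc t)))"
proof -
  define X Y K T R where "X = b ^ t" and "Y = b ^ s" and "K = beta_coeff b s t"
    and "T = of_bool (t > 0) * beta_coeff b (Suc s) (t - 1)"
    and "R = of_bool (s > 0) * beta_coeff b (s - 1) (Suc t)"
  have nz: "b * X - 1 \<noteq> 0" "X \<noteq> 0" "Y \<noteq> 0" "b \<noteq> 0"
    using power_Suc_neq_1(4)[of t] b_nonzero by (auto simp: X_def Y_def)
  have T: "T * (b\<^sup>2 * Y\<^sup>2 - 1) * X = b * (X - 1) * K"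
    unfolding T_def X_def Y_def K_def by (rule beta_coeff_lower)
  have pw: "b ^ (2 * (s + t)) = Y\<^sup>2 * X\<^sup>2" "b ^ (2 * s) = Y\<^sup>2" "b ^ (2 * Suc s) = b\<^sup>2 * Y\<^sup>2"
    unfolding power_even_eq power_add power_Suc X_def Y_def by (simp_all add: power_mult_distrib)
  have "- b * (Y\<^sup>2 * X\<^sup>2 - Y\<^sup>2 * X\<^sup>2 / (b\<^sup>2 * Y\<^sup>2)) * T = - (X / b) * (T * (b\<^sup>2 * Y\<^sup>2 - 1) * X)"
    using nz by (simp add: field_simps power2_eq_square)
  also have "\<dots> = - (X * (X - 1) * K)" unfolding T using nz by simp
  finally have T': "- b * (Y\<^sup>2 * X\<^sup>2 - Y\<^sup>2 * X\<^sup>2 / (b\<^sup>2 * Y\<^sup>2)) * T = - (X * (X - 1) * K)" .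
  have "of_bool (t > 0) * ((- 1) ^ (t - 1) * beta_coeff b (Suc s) (t - 1)) = - ((- 1) ^ t * T)"
    by (cases t) (simp_all add: T_def)
  then have "- b * (b ^ (2 * (s + t)) - b ^ (2 * (s + t)) / b ^ (2 * Suc s))
        * (of_bool (t > 0) * ((- 1) ^ (t - 1) * beta_coeff b (Suc s) (t - 1)))
      = - ((- 1) ^ t) * (- b * (Y\<^sup>2 * X\<^sup>2 - Y\<^sup>2 * X\<^sup>2 / (b\<^sup>2 * Y\<^sup>2)) * T)"
    unfolding pw by (simp only: mult_ac minus_mult_left[symmetric] minus_mult_right[symmetric] minus_minus)
  also have "\<dots> = (- 1) ^ t * (X * (X - 1) * K)" unfolding T' by simp
  finally have 1: "- b * (b ^ (2 * (s + t)) - b ^ (2 * (s + t)) / b ^ (2 * Suc s))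
        * (of_bool (t > 0) * ((- 1) ^ (t - 1) * beta_coeff b (Suc s) (t - 1)))
      = (- 1) ^ t * (X * (X - 1) * K)" .
  have 2: "b ^ (2 * (s + t)) / b ^ (2 * s) = X\<^sup>2" unfolding pw using nz by simp
  have "of_bool (s > 0) * (b ^ (2 * (s + t)) / b ^ (2 * (s - 1)) * ((- 1) ^ Suc t * beta_coeff b (s - 1) (Suc t)))
      = (- 1) ^ t * (- (b\<^sup>2 * X\<^sup>2) * R)"
  proof (cases s)
    case (Suc r)
    have "b ^ (2 * s) = b\<^sup>2 * b ^ (2 * r)" unfolding Suc by (simp add: power2_eq_square)
    then have "b ^ (2 * (s + t)) / b ^ (2 * r) = b\<^sup>2 * X\<^sup>2"
      using pw(1,2) nz by (simp add: field_simps)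
    then show ?thesis using Suc by (simp add: R_def)
  qed (simp add: R_def)
  also have "R = X * (Y\<^sup>2 - 1) / (b * X - 1) * K"
    unfolding R_def beta_coeff_raise X_def Y_def K_def ..
  finally have 3: "of_bool (s > 0) * (b ^ (2 * (s + t)) / b ^ (2 * (s - 1)) * ((- 1) ^ Suc t * beta_coeff b (s - 1) (Suc t)))
      = (- 1) ^ t * (- (b\<^sup>2 * X\<^sup>2) * (X * (Y\<^sup>2 - 1) / (b * X - 1) * K))" .
  define A B where "A = X * (b\<^sup>2 * X\<^sup>2 * Y\<^sup>2 - 1) / (b * X - 1)" and "B = X * (Y\<^sup>2 - 1) / (b * X - 1)"
  have AB: "- A = X * (X - 1) + (- b - 1) * X\<^sup>2 + - (b\<^sup>2 * X\<^sup>2) * B"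
    using nz unfolding A_def B_def by (simp add: divide_simps) (simp add: power2_eq_square algebra_simps)
  have "(- 1) ^ Suc t * (A * K) = (- 1) ^ t * K * - A" by simp
  then have "(- 1) ^ Suc t * (A * K) = (- 1) ^ t * (X * (X - 1) * K) + (- b - 1) * X\<^sup>2 * ((- 1) ^ t * K)
      + (- 1) ^ t * (- (b\<^sup>2 * X\<^sup>2) * (B * K))"
    unfolding AB by (simp add: algebra_simps)
  then show ?thesis
    unfolding 1 2 3 beta_coeff_Suc_right'[of s t] X_def[symmetric] Y_def[symmetric] K_def[symmetric]
      A_def[symmetric] B_def[symmetric] .
qed

end

lemma newton_Suc: "newton b (Suc j) y = newton b j y * (y - b ^ j)"
  by (simp add: newton_def)

lemma newton_expansion:
  assumes b: "\<bar>b\<bar> > 1"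
  shows "(\<Prod>i<d. y\<^sup>2 - b ^ (2 * i)) = (\<Sum>s\<le>d. beta_coeff b s (d - s) * newton b (d + s) y)"
proof (induction d)
  case 0
  then show ?case using b by (simp add: newton_def)
next
  case (Suc d)
  let ?B = "\<lambda>s. beta_coeff b s (d - s)" and ?N = "\<lambda>m. newton b m y"
  \<comment> \<open>From y^2 = (y - b^m)(y - b^(m+1)) + b^m (1 + b)(y - b^m) + b^(2m). For m = d the
    last coefficient vanishes, so no index below d + 1 survives.\<close>
  have step: "?N m * (y\<^sup>2 - b ^ (2 * d))
      = ?N (Suc (Suc m)) + b ^ m * (1 + b) * ?N (Suc m) + (b ^ (2 * m) - b ^ (2 * d)) * ?N m" for m
  proof -
    have "b ^ (2 * m) = b ^ m * b ^ m" by (simp add: mult_2 power_add)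
    then show ?thesis unfolding newton_Suc power_Suc power2_eq_square by (simp add: algebra_simps)
  qed
  have "(\<Prod>i<Suc d. y\<^sup>2 - b ^ (2 * i)) = (\<Sum>s\<le>d. ?B s * (?N (d + s) * (y\<^sup>2 - b ^ (2 * d))))"
    by (simp add: Suc sum_distrib_right mult.assoc)
  also have "\<dots> = (\<Sum>s\<le>d. ?B s * ?N (Suc d + Suc s))
      + (\<Sum>s\<le>d. b ^ (d + s) * (1 + b) * ?B s * ?N (Suc d + s))
      + (\<Sum>s\<le>d. (b ^ (2 * (d + s)) - b ^ (2 * d)) * ?B s * ?N (d + s))"
    unfolding step sum.distrib[symmetric]
    by (rule sum.cong) (simp_all add: algebra_simps)
  also have "(\<Sum>s\<le>d. ?B s * ?N (Suc d + Suc s))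
      = (\<Sum>s\<le>Suc d. of_bool (s > 0) * beta_coeff b (s - 1) (Suc d - s) * ?N (Suc d + s))"
    by (subst sum.atMost_Suc_shift) simp
  also have "(\<Sum>s\<le>d. b ^ (d + s) * (1 + b) * ?B s * ?N (Suc d + s))
      = (\<Sum>s\<le>Suc d. of_bool (s \<le> d) * (b ^ (d + s) * (1 + b) * ?B s) * ?N (Suc d + s))"
    by simp
  also have "(\<Sum>s\<le>d. (b ^ (2 * (d + s)) - b ^ (2 * d)) * ?B s * ?N (d + s))
      = (\<Sum>s<d. (b ^ (2 * (d + Suc s)) - b ^ (2 * d)) * ?B (Suc s) * ?N (d + Suc s))"
    by (simp only: lessThan_Suc_atMost[symmetric] sum.lessThan_Suc_shift) simp
  also have "\<dots> = (\<Sum>s\<le>Suc d. of_bool (s < d) * ((b ^ (2 * (d + Suc s)) - b ^ (2 * d)) * ?B (Suc s)) * ?N (Suc d + s))"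
    by (simp add: lessThan_Suc_atMost[symmetric])
  finally have "(\<Prod>i<Suc d. y\<^sup>2 - b ^ (2 * i)) = (\<Sum>s\<le>Suc d.
      (of_bool (s > 0) * beta_coeff b (s - 1) (Suc d - s) + of_bool (s \<le> d) * (b ^ (d + s) * (1 + b) * ?B s)
       + of_bool (s < d) * ((b ^ (2 * (d + Suc s)) - b ^ (2 * d)) * ?B (Suc s))) * ?N (Suc d + s))"
    by (simp only: sum.distrib distrib_right)
  also have "\<dots> = (\<Sum>s\<le>Suc d. beta_coeff b s (Suc d - s) * ?N (Suc d + s))"
  proof (rule sum.cong[OF refl])
    fix s assume "s \<in> {..Suc d}"
    then consider "s = Suc d" | t where "d = s + t" by (metis atMost_iff le_Suc_eq le_Suc_ex)
    then show "(of_bool (s > 0) * beta_coeff b (s - 1) (Suc d - s) + of_bool (s \<le> d) * (b ^ (d + s) * (1 + b) * ?B s)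
       + of_bool (s < d) * ((b ^ (2 * (d + Suc s)) - b ^ (2 * d)) * ?B (Suc s))) * ?N (Suc d + s)
      = beta_coeff b s (Suc d - s) * ?N (Suc d + s)"
    proof cases
      case 2
      have "Suc d - s = Suc t" "d - s = t" "d - Suc s = t - 1" using 2 by auto
      then show ?thesis using newton_coeff_recursion[OF b, of s t] 2 by simp
    qed (use b in simp)
  qed
  finally show ?case .
qed

lemma newton_power_eq_0: "k < j \<Longrightarrow> newton b j (b ^ k) = 0"
  by (auto simp: newton_def)

text \<open>Descending induction on j. For j > n the polynomial vanishes at all sample points. For j
  <= n the moment with d = j involves the indices j to 2j, with nonzero coefficient
  \<open>beta_coeff b 0 j\<close> at the lowest; the claimed values fit because j + s and j - s have
  equal parity.\<close>

lemma newton_moments: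
  fixes K :: "'g \<Rightarrow> nat" and b M :: real
  assumes b: "\<bar>b\<bar> > 1" and K: "\<And>g. g \<in> G \<Longrightarrow> K g \<le> n"
    and moments: "\<And>d. (\<Sum>g\<in>G. \<Prod>i<d. (b ^ K g)\<^sup>2 - b ^ (2 * i))
      = M * (\<Sum>s\<le>d. of_bool (d + s \<le> n) * ((- 1) ^ (d - s) * beta_coeff b s (d - s)))"
  shows "(\<Sum>g\<in>G. newton b j (b ^ K g)) = of_bool (j \<le> n) * ((- 1) ^ j * M)"
proof (induction "n - j" arbitrary: j rule: less_induct)
  case less
  let ?m = "\<lambda>j. \<Sum>g\<in>G. newton b j (b ^ K g)"
  have zero: "?m j = 0" if "j > n" for j
    using K that by (intro sum.neutral ballI newton_power_eq_0) fastforce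
  show ?case
  proof (cases "j \<le> n")
    case True
    have higher: "?m (j + Suc s) = of_bool (j + Suc s \<le> n) * ((- 1) ^ (j + Suc s) * M)" for s
      using less.hyps[of "j + Suc s"] zero[of "j + Suc s"] True by (cases "j + Suc s \<le> n") auto
    have sign: "(- 1) ^ (j + Suc s) = (- 1 :: real) ^ (j - Suc s)" if "s < j" for s
    proof -
      have "j + Suc s = (j - Suc s) + 2 * Suc s" using that by simp
      then show ?thesis by (metis power_add power_minus1_even mult.right_neutral)
    qed
    have "M * (\<Sum>s\<le>j. of_bool (j + s \<le> n) * ((- 1) ^ (j - s) * beta_coeff b s (j - s)))
        = (\<Sum>s\<le>j. beta_coeff b s (j - s) * ?m (j + s))"
      unfolding moments[symmetric] unfolding newton_expansion[OF b] sum_distrib_left by (rule sum.swap)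
    moreover have "(\<Sum>s<j. beta_coeff b (Suc s) (j - Suc s) * ?m (j + Suc s))
        = M * (\<Sum>s<j. of_bool (j + Suc s \<le> n) * ((- 1) ^ (j - Suc s) * beta_coeff b (Suc s) (j - Suc s)))"
      unfolding sum_distrib_left higher by (rule sum.cong) (simp_all only: sign lessThan_iff mult_ac)
    ultimately have "beta_coeff b 0 j * ?m j = M * ((- 1) ^ j * beta_coeff b 0 j)"
      using True
      by (auto simp: lessThan_Suc_atMost[symmetric] sum.lessThan_Suc_shift distrib_left simp del: sum.lessThan_Suc)
    then show ?thesis using beta_coeff_nonzero[OF b, of 0 j] True by (simp add: mult_ac)
  qed (use zero in simp)
qed

section \<open>Interpolation at the nodes \<open>b ^ k\<close>, with p = 1 / b\<close>

context
  fixes b p :: real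
  assumes b: "\<bar>b\<bar> > 1" and bp: "b * p = 1"
begin

lemma p_power_neq_1: "1 - p * p ^ i \<noteq> 0"
proof
  assume "1 - p * p ^ i = 0"
  then have "b ^ Suc i = b ^ Suc i * p ^ Suc i" by simp
  also have "\<dots> = 1" using bp by (simp only: power_mult_distrib[symmetric]) simp
  finally show False using power_neq_1[OF b, of "Suc i"] by simp
qed

lemma qpoch_p_nonzero: "qpoch p p m \<noteq> 0"
  using p_power_neq_1 by (simp add: qpoch_def)

lemma bp_power: "b ^ i * p ^ i = 1"
  using bp by (simp flip: power_mult_distrib)

lemma binomial_sum_term:
  "(- 1) ^ Suc m * p ^ ((Suc m choose 2) + Suc m) / qpoch p p (Suc m) * newton b (Suc m) x
    = p ^ Suc m * (1 - x) * (\<Prod>l<m. 1 - p ^ Suc l * x) / qpoch p p (Suc m)"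
proof (induction m)
  case 0
  show ?case
    using qpoch_p_nonzero[of "Suc 0"] by (simp add: newton_def binomial_eq_0 field_simps)
next
  case (Suc m)
  let ?j = "Suc m"
  have e: "(Suc ?j choose 2) + Suc ?j = ((?j choose 2) + ?j) + Suc ?j" by (simp add: numeral_2_eq_2)
  have pb: "p ^ Suc ?j * (x - b ^ ?j) = - p * (1 - p ^ ?j * x)"
    using bp_power[of ?j] by (simp add: algebra_simps)
  have "(- 1) ^ Suc ?j * p ^ ((Suc ?j choose 2) + Suc ?j) / qpoch p p (Suc ?j) * newton b (Suc ?j) x
      = ((- 1) ^ ?j * p ^ ((?j choose 2) + ?j) / qpoch p p ?j * newton b ?j x)
        * (- (p ^ Suc ?j * (x - b ^ ?j)) / (1 - p * p ^ ?j))"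
    unfolding e newton_Suc power_add[of p "(?j choose 2) + ?j"] by (simp add: qpoch_def)
  also have "\<dots> = p ^ Suc m * (1 - x) * (\<Prod>l<m. 1 - p ^ Suc l * x) / qpoch p p (Suc m)
        * (p * (1 - p ^ ?j * x) / (1 - p * p ^ ?j))"
    unfolding Suc pb by simp
  also have "\<dots> = p ^ Suc ?j * (1 - x) * (\<Prod>l<?j. 1 - p ^ Suc l * x) / qpoch p p (Suc ?j)"
    by (simp add: qpoch_def mult_ac)
  finally show ?case .
qed

text \<open>A finite q-binomial sum, telescoping through \<open>binomial_sum_term\<close>. At x =
  b^r with 1 <= r <= m the factor l = r - 1 vanishes, so the sum separates x = 1 from these
  nodes.\<close>

lemma binomial_partial_sum:
  "(\<Sum>i\<le>m. (- 1) ^ i * p ^ ((i choose 2) + i) / qpoch p p i * newton b i x)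
    = (\<Prod>l<m. 1 - p ^ Suc l * x) / qpoch p p m"
proof (induction m)
  case 0
  then show ?case by (simp add: newton_def qpoch_def binomial_eq_0)
next
  case (Suc m)
  have "(\<Sum>i\<le>Suc m. (- 1) ^ i * p ^ ((i choose 2) + i) / qpoch p p i * newton b i x)
      = (\<Prod>l<m. 1 - p ^ Suc l * x) / qpoch p p m
        + p ^ Suc m * (1 - x) * (\<Prod>l<m. 1 - p ^ Suc l * x) / qpoch p p (Suc m)"
    unfolding sum.atMost_Suc Suc binomial_sum_term ..
  also have "(\<Prod>l<m. 1 - p ^ Suc l * x) / qpoch p p m
      = (1 - p * p ^ m) * (\<Prod>l<m. 1 - p ^ Suc l * x) / qpoch p p (Suc m)"
    using p_power_neq_1[of m] by (simp add: qpoch_def)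
  also have "\<dots> + p ^ Suc m * (1 - x) * (\<Prod>l<m. 1 - p ^ Suc l * x) / qpoch p p (Suc m)
      = (\<Prod>l<Suc m. 1 - p ^ Suc l * x) / qpoch p p (Suc m)"
    unfolding add_divide_distrib[symmetric] prod.lessThan_Suc
    by (rule arg_cong[of _ _ "\<lambda>z. z / _"]) (simp add: algebra_simps)
  finally show ?case .
qed

lemma newton_add: "newton b (k + i) (b ^ (k + m)) = newton b k (b ^ (k + m)) * (b ^ (k * i) * newton b i (b ^ m))"
proof (induction i)
  case (Suc i)
  have "b ^ (k + m) - b ^ (k + i) = b ^ k * (b ^ m - b ^ i)" by (simp add: power_add algebra_simps)
  then show ?case using Suc by (simp add: newton_Suc power_add mult_ac)
qed (simp add: newton_def)

lemma newton_diagonal: "p ^ k\<^sup>2 * newton b k (b ^ k) = qpoch p p k"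
proof -
  have "newton b k (b ^ k) = (\<Prod>i<k. b ^ k * (1 - p ^ (k - i)))"
    unfolding newton_def
  proof (rule prod.cong[OF refl])
    fix i assume "i \<in> {..<k}"
    then have "b ^ k = b ^ i * b ^ (k - i)" by (simp flip: power_add)
    then show "b ^ k - b ^ i = b ^ k * (1 - p ^ (k - i))"
      using bp_power[of "k - i"] by (simp add: right_diff_distrib mult.assoc)
  qed
  also have "\<dots> = b ^ k\<^sup>2 * (\<Prod>i<k. 1 - p ^ (k - i))"
    by (simp add: prod.distrib power2_eq_square power_mult)
  also have "(\<Prod>i<k. 1 - p ^ (k - i)) = (\<Prod>i<k. 1 - p * p ^ i)"
    by (subst prod.nat_diff_reindex[symmetric])
      (auto intro!: prod.cong simp flip: power_Suc simp: Suc_diff_Suc)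
  finally show ?thesis
    using bp_power[of "k\<^sup>2"] by (simp add: qpoch_def mult.assoc[symmetric] mult.commute[of "p ^ _"])
qed

text \<open>Lagrange interpolation in the Newton basis. For K < k every polynomial vanishes. For K =
  k + m, \<open>newton_add\<close> moves the nodes down by k, and the sum of
  \<open>binomial_partial_sum\<close> at b^m detects m = 0; stopping at n - k suffices since m <= n
  - k.\<close>

lemma indicator_newton:
  assumes "K \<le> n" "k \<le> n"
  shows "p ^ k\<^sup>2 / qpoch p p k * (\<Sum>i\<le>n - k. (- 1) ^ i * p ^ ((i choose 2) + (k + 1) * i) / qpoch p p i
      * newton b (k + i) (b ^ K)) = of_bool (K = k)"
proof (cases "k \<le> K")
  case True
  then obtain m where m: "K = k + m" using le_Suc_ex by blast
  have "(\<Sum>i\<le>n - k. (- 1) ^ i * p ^ ((i choose 2) + (k + 1) * i) / qpoch p p i * newton b (k + i) (b ^ K))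
      = (\<Sum>i\<le>n - k. newton b k (b ^ K) * ((- 1) ^ i * p ^ ((i choose 2) + i) / qpoch p p i * newton b i (b ^ m)))"
  proof (rule sum.cong[OF refl])
    fix i
    have "p ^ ((i choose 2) + (k + 1) * i) * b ^ (k * i) = p ^ ((i choose 2) + i)"
      using bp_power[of "k * i"] by (simp add: power_add algebra_simps)
    then show "(- 1) ^ i * p ^ ((i choose 2) + (k + 1) * i) / qpoch p p i * newton b (k + i) (b ^ K)
      = newton b k (b ^ K) * ((- 1) ^ i * p ^ ((i choose 2) + i) / qpoch p p i * newton b i (b ^ m))"
      unfolding m newton_add by (simp add: mult_ac flip: \<open>_ = p ^ ((i choose 2) + i)\<close>)
  qed
  also have "\<dots> = newton b k (b ^ K) * ((\<Prod>l<n - k. 1 - p ^ Suc l * b ^ m) / qpoch p p (n - k))"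
    unfolding sum_distrib_left[symmetric] binomial_partial_sum ..
  also have "\<dots> = of_bool (m = 0) * newton b k (b ^ k)"
  proof (cases m)
    case 0
    then show ?thesis using qpoch_p_nonzero[of "n - k"] m by (simp add: qpoch_def)
  next
    case (Suc r)
    have "1 - p ^ Suc r * b ^ m = 0" using bp_power[of "Suc r"] Suc by (simp add: mult.commute)
    moreover have "r < n - k" using Suc m assms by simp
    ultimately have "(\<Prod>l<n - k. 1 - p ^ Suc l * b ^ m) = 0" by (intro prod_zero) auto
    then show ?thesis using Suc by simp
  qed
  finally show ?thesis
    using newton_diagonal[of k] qpoch_p_nonzero[of k] m by (simp add: field_simps)
qed (auto simp: newton_power_eq_0)

end

section \<open>Distribution of the dimension of the fixed space\<close>

context hermitian_space
begin

lemma stab_sum_eq: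
  "stab_sum d s = of_bool (d + s \<le> n \<and> s \<le> d) * ((- 1) ^ (d - s) * beta_coeff (- real q) s (d - s))
    * card isometries"
proof (induction d arbitrary: s)
  case 0
  have "\<bar>- real q\<bar> > 1" using q_gt_1 by simp
  then show ?case by (cases s) (auto simp: stab_sum_0)
next
  case (Suc d)
  let ?b = "- real q" and ?M = "real (card isometries)"
  have b: "\<bar>?b\<bar> > 1" using q_gt_1 by simp
  have even: "?b ^ (2 * m) = real q ^ (2 * m)" for m by simp
  consider "s > Suc d" | "s = Suc d" | t where "d = s + t"
    by (metis le_Suc_ex linorder_not_le not_less_eq_eq order_le_less)
  then show ?case
  proof cases
    case 1
    then show ?thesis by (auto simp: stab_sum_Suc Suc)
  next
    case 2
    then show ?thesis using b q_gt_1 by (auto simp: stab_sum_Suc Suc)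
  next
    case 3
    define T where "T = of_bool (t > 0) * ((- 1) ^ (t - 1) * beta_coeff ?b (Suc s) (t - 1))"
    \<comment> \<open>The guard d + 1 + s <= n coincides with the dimension bound of
      \<open>stab_sum d (Suc s)\<close> and implies those of the other two neighbours, so it factors
      out.\<close>
    have 1: "stab_sum d (Suc s) = of_bool (d + 1 + s \<le> n) * T * ?M"
      unfolding Suc T_def using 3 by (cases t) auto
    have 2: "of_bool (d + 1 + s \<le> n) * stab_sum d s
        = of_bool (d + 1 + s \<le> n) * ((- 1) ^ t * beta_coeff ?b s t) * ?M"
      unfolding Suc using 3 by auto
    have raise: "of_bool (d + 1 + s \<le> n) * (of_bool (s > 0) * stab_sum d (s - 1))
        = of_bool (d + 1 + s \<le> n) * (of_bool (s > 0) * ((- 1) ^ Suc t * beta_coeff ?b (s - 1) (Suc t))) * ?M"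
      unfolding Suc using 3 by (cases s) auto
    let ?t = "of_bool (d + 1 + s \<le> n) :: real"
    have "stab_sum (Suc d) s =
      real q * (real q ^ (2 * d) - real q ^ (2 * d) / real q ^ (2 * Suc s)) * stab_sum d (Suc s)
      + (real q - 1) * (real q ^ (2 * d) / real q ^ (2 * s)) * (?t * stab_sum d s)
      + real q ^ (2 * d) / real q ^ (2 * (s - 1)) * (?t * (of_bool (s > 0) * stab_sum d (s - 1)))"
      unfolding stab_sum_Suc by (simp only: distrib_left mult_ac add.assoc)
    also have "\<dots> = ?t * ?M * (real q * (real q ^ (2 * d) - real q ^ (2 * d) / real q ^ (2 * Suc s)) * T
      + (real q - 1) * (real q ^ (2 * d) / real q ^ (2 * s)) * ((- 1) ^ t * beta_coeff ?b s t)
      + of_bool (s > 0) * (real q ^ (2 * d) / real q ^ (2 * (s - 1)) * ((- 1) ^ Suc t * beta_coeff ?b (s - 1) (Suc t))))"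
      unfolding 1 2 raise by (simp only: distrib_left mult_ac)
    also have "\<dots> = ?t * ?M * ((- 1) ^ Suc t * beta_coeff ?b s (Suc t))"
      unfolding gram_coeff_recursion[OF b, where s = s and t = t] even T_def 3 minus_minus ..
    finally have "stab_sum (Suc d) s = ?t * ?M * ((- 1) ^ Suc t * beta_coeff ?b s (Suc t))" .
    moreover have "Suc d - s = Suc t" using 3 by simp
    moreover have "Suc d + s \<le> n \<and> s \<le> Suc d \<longleftrightarrow> d + 1 + s \<le> n" using 3 by arith
    ultimately show ?thesis by (simp only:) (simp only: mult_ac)
  qed
qed

lemma card_isometries_fixed_space:
  assumes p: "p = - 1 / real q"
  shows "real (card {g \<in> isometries. card {v \<in> V. g v = v} = CARD('a) ^ k})
    = real (card isometries) * (of_bool (k \<le> n) * ((- 1) ^ k * p ^ k\<^sup>2 / qpoch p p k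
        * (\<Sum>i\<le>n - k. p ^ ((i choose 2) + (k + 1) * i) / qpoch p p i)))"
proof -
  let ?b = "- real q" and ?M = "real (card isometries)"
  have b: "\<bar>?b\<bar> > 1" and bp: "?b * p = 1" using q_gt_1 by (auto simp: p)
  have "\<forall>g\<in>isometries. \<exists>m. card {v \<in> V. g v = v} = CARD('a) ^ m"
    using card_subspace_power[OF subspace_fixed_space] by blast
  then obtain K where K: "\<And>g. g \<in> isometries \<Longrightarrow> card {v \<in> V. g v = v} = CARD('a) ^ K g" by metis
  have K_le: "K g \<le> n" if "g \<in> isometries" for g
  proof -
    have "CARD('a) ^ K g \<le> CARD('a) ^ n"
      using K[OF that] card_mono[of V "{v \<in> V. g v = v}"] card_V by simp
    then show ?thesis using power_le_imp_le_exp[OF card_field_gt_1] by blast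
  qed
  have even: "?b ^ (2 * m) = real q ^ (2 * m)" for m by simp
  have moments: "(\<Sum>g\<in>isometries. \<Prod>i<d. (?b ^ K g)\<^sup>2 - ?b ^ (2 * i))
      = ?M * (\<Sum>s\<le>d. of_bool (d + s \<le> n) * ((- 1) ^ (d - s) * beta_coeff ?b s (d - s)))" for d
  proof -
    have "(?b ^ K g)\<^sup>2 = real (card {v \<in> V. g v = v})" if "g \<in> isometries" for g
      unfolding K[OF that] using even[of "K g"]
      by (simp add: card_field power_mult mult.commute flip: power_mult)
    then have "(\<Sum>g\<in>isometries. \<Prod>i<d. (?b ^ K g)\<^sup>2 - ?b ^ (2 * i)) = (\<Sum>s\<le>d. stab_sum d s)"
      unfolding sum_fixed_space_moments[symmetric] even by simp
    also have "\<dots> = ?M * (\<Sum>s\<le>d. of_bool (d + s \<le> n) * ((- 1) ^ (d - s) * beta_coeff ?b s (d - s)))"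
      unfolding stab_sum_eq sum_distrib_left by (rule sum.cong) (auto simp: mult_ac)
    finally show ?thesis .
  qed
  have count: "real (card {g \<in> isometries. card {v \<in> V. g v = v} = CARD('a) ^ k})
      = (\<Sum>g\<in>isometries. of_bool (K g = k))"
  proof -
    have "{g \<in> isometries. card {v \<in> V. g v = v} = CARD('a) ^ k} = isometries \<inter> {g. K g = k}"
      using K card_power_field_eq_iff by auto
    then show ?thesis by (simp add: of_bool_def sum.If_cases)
  qed
  show ?thesis
  proof (cases "k \<le> n")
    case True
    let ?c = "\<lambda>i. (- 1) ^ i * p ^ ((i choose 2) + (k + 1) * i) / qpoch p p i"
    have "(\<Sum>g\<in>isometries. of_bool (K g = k))
        = (\<Sum>g\<in>isometries. p ^ k\<^sup>2 / qpoch p p k * (\<Sum>i\<le>n - k. ?c i * newton ?b (k + i) (?b ^ K g)))"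
      by (rule sum.cong[OF refl]) (rule indicator_newton[OF b bp K_le True, symmetric])
    also have "\<dots> = p ^ k\<^sup>2 / qpoch p p k * (\<Sum>i\<le>n - k. ?c i * (\<Sum>g\<in>isometries. newton ?b (k + i) (?b ^ K g)))"
      unfolding sum_distrib_left by (rule sum.swap)
    also have "(\<Sum>i\<le>n - k. ?c i * (\<Sum>g\<in>isometries. newton ?b (k + i) (?b ^ K g)))
        = (\<Sum>i\<le>n - k. ?M * (- 1) ^ k * (p ^ ((i choose 2) + (k + 1) * i) / qpoch p p i))"
    proof (rule sum.cong[OF refl])
      fix i assume "i \<in> {..n - k}"
      then have "k + i \<le> n" using True by simp
      then have "(\<Sum>g\<in>isometries. newton ?b (k + i) (?b ^ K g)) = (- 1) ^ (k + i) * ?M"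
        using newton_moments[OF b K_le moments, of "k + i"] by simp
      \<comment> \<open>The sign (-1)^(k + i) of the Newton mean meets the (-1)^i of the
        interpolation; only (-1)^k remains, and the sum takes the shape of Euler's series.\<close>
      then show "?c i * (\<Sum>g\<in>isometries. newton ?b (k + i) (?b ^ K g))
          = ?M * (- 1) ^ k * (p ^ ((i choose 2) + (k + 1) * i) / qpoch p p i)"
        by (simp add: power_add flip: power_mult_distrib)
    qed
    also have "\<dots> = ?M * (- 1) ^ k * (\<Sum>i\<le>n - k. p ^ ((i choose 2) + (k + 1) * i) / qpoch p p i)"
      by (rule sum_distrib_left[symmetric])
    finally show ?thesis unfolding count using True by simp
  next
    case False
    then have "(\<Sum>g\<in>isometries. of_bool (K g = k)) = (0 :: real)"
      using K_le by (intro sum.neutral) auto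
    then show ?thesis unfolding count using False by simp
  qed
qed

end

section \<open>Euler's identity and the geometric mixture\<close>

text \<open>The series satisfies f x = (1 + x) f (p x). Iteration gives a partial product times f
  (p^m x), which tends to f 0 = 1 by continuity. Ratios of successive terms tend to 0, so
  convergence holds for every x.\<close>

lemma euler_qpoch_inf:
  fixes p x :: real
  assumes p: "\<bar>p\<bar> < 1"
  defines "e \<equiv> \<lambda>i. p ^ (i choose 2) / qpoch p p i"
  shows "summable (\<lambda>i. norm (e i * x ^ i))" "(\<Sum>i. e i * x ^ i) = qpoch_inf (- x) p"
proof -
  have nz: "1 - p * p ^ i \<noteq> 0" for i
  proof -
    have "\<bar>p\<bar> * \<bar>p\<bar> ^ i \<le> \<bar>p\<bar> * 1" using p by (intro mult_left_mono power_le_one) auto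
    then have "\<bar>p * p ^ i\<bar> < 1" using p by (simp add: abs_mult power_abs)
    then show ?thesis by auto
  qed
  have e_Suc: "e (Suc i) * (1 - p * p ^ i) = p ^ i * e i" for i
  proof -
    have "Suc i choose 2 = i + (i choose 2)" by (simp add: numeral_2_eq_2)
    then show ?thesis using nz[of i] by (simp add: e_def qpoch_def power_add)
  qed
  have e_0: "e 0 = 1" by (simp add: e_def qpoch_def binomial_eq_0)
  show summ: "summable (\<lambda>i. norm (e i * x ^ i))" for x
  proof -
    have "(\<lambda>i. p ^ i * x / (1 - p * p ^ i)) \<longlonglongrightarrow> 0 * x / (1 - p * 0)"
      using p by (intro tendsto_intros LIMSEQ_power_zero) auto
    then have "eventually (\<lambda>i. norm (p ^ i * x / (1 - p * p ^ i)) < 1 / 2) sequentially"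
      by (intro order_tendstoD(2)[OF tendsto_norm]) auto
    then obtain N where N: "\<And>i. i \<ge> N \<Longrightarrow> norm (p ^ i * x / (1 - p * p ^ i)) < 1 / 2"
      by (auto simp: eventually_sequentially)
    show ?thesis
    proof (rule summable_ratio_test[of "1 / 2" N])
      fix i assume "i \<ge> N"
      have "e (Suc i) * x ^ Suc i = p ^ i * x / (1 - p * p ^ i) * (e i * x ^ i)"
      proof -
        have "e (Suc i) = p ^ i * e i / (1 - p * p ^ i)" using e_Suc[of i] nz[of i] by (simp add: eq_divide_eq)
        then show ?thesis by simp
      qed
      then show "norm (norm (e (Suc i) * x ^ Suc i)) \<le> 1 / 2 * norm (norm (e i * x ^ i))"
        using N[OF \<open>i \<ge> N\<close>] by (simp only: norm_mult real_norm_def abs_abs abs_mult)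
          (intro mult_right_mono, auto)
    qed simp
  qed
  define f where "f x = (\<Sum>i. e i * x ^ i)" for x
  have summ': "summable (\<lambda>i. e i * x ^ i)" for x using summ by (rule summable_norm_cancel)
  have f_eq: "f x = (1 + x) * f (p * x)" for x
  proof -
    have "f x - f (p * x) = (\<Sum>i. e i * x ^ i - e i * (p * x) ^ i)"
      unfolding f_def by (intro suminf_diff summ')
    also have "\<dots> = (\<Sum>i. e i * (1 - p ^ i) * x ^ i)"
      by (simp add: power_mult_distrib algebra_simps)
    also have "\<dots> = (\<Sum>i. e (Suc i) * (1 - p ^ Suc i) * x ^ Suc i)"
    proof (subst suminf_split_head)
      have "summable (\<lambda>i. e i * x ^ i - e i * (p * x) ^ i)" by (intro summable_diff summ')
      then show "summable (\<lambda>i. e i * (1 - p ^ i) * x ^ i)"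
        by (simp add: power_mult_distrib algebra_simps)
    qed simp
    also have "\<dots> = (\<Sum>i. x * (e i * (p * x) ^ i))"
      by (intro suminf_cong) (use e_Suc in \<open>simp add: power_mult_distrib mult_ac\<close>)
    also have "\<dots> = x * f (p * x)" unfolding f_def by (intro suminf_mult summ')
    finally show ?thesis by (simp add: algebra_simps)
  qed
  have f_prod: "f x = (\<Prod>r<m. 1 + x * p ^ r) * f (p ^ m * x)" for m
  proof (induction m)
    case (Suc m)
    then show ?case using f_eq[of "p ^ m * x"] by (simp add: mult_ac)
  qed simp
  have "isCont f 0"
    unfolding f_def by (rule isCont_powser[OF summ'[of 1]]) simp
  moreover have "(\<lambda>m. p ^ m * x) \<longlonglongrightarrow> 0 * x" using p by (intro tendsto_intros LIMSEQ_power_zero) auto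
  ultimately have "(\<lambda>m. f (p ^ m * x)) \<longlonglongrightarrow> f 0"
    using isCont_tendsto_compose[of 0 f] by simp
  moreover have "f 0 = 1" unfolding f_def using e_0 by (simp add: powser_zero)
  moreover have conv: "convergent_prod (\<lambda>r. 1 + x * p ^ r)"
  proof (rule abs_convergent_prod_imp_convergent_prod, rule summable_imp_abs_convergent_prod)
    have "summable (\<lambda>r. \<bar>x\<bar> * \<bar>p\<bar> ^ r)" using p by (intro summable_mult summable_geometric) auto
    then show "summable (\<lambda>r. norm (1 + x * p ^ r - 1))" by (simp add: abs_mult power_abs)
  qed
  then have "(\<lambda>m. \<Prod>r\<le>m. 1 + x * p ^ r) \<longlonglongrightarrow> prodinf (\<lambda>r. 1 + x * p ^ r)"
    by (rule convergent_prod_LIMSEQ)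
  then have "(\<lambda>m. \<Prod>r<Suc m. 1 + x * p ^ r) \<longlonglongrightarrow> prodinf (\<lambda>r. 1 + x * p ^ r)"
    by (simp only: lessThan_Suc_atMost)
  then have "(\<lambda>m. \<Prod>r<m. 1 + x * p ^ r) \<longlonglongrightarrow> prodinf (\<lambda>r. 1 + x * p ^ r)"
    by (rule LIMSEQ_imp_Suc)
  ultimately have "(\<lambda>m. (\<Prod>r<m. 1 + x * p ^ r) * f (p ^ m * x)) \<longlonglongrightarrow> prodinf (\<lambda>r. 1 + x * p ^ r) * 1"
    by (metis tendsto_mult)
  then have "f x = prodinf (\<lambda>r. 1 + x * p ^ r)"
    unfolding f_prod[symmetric] by (simp add: LIMSEQ_const_iff)
  then show "(\<Sum>i. e i * x ^ i) = qpoch_inf (- x) p" by (simp add: f_def qpoch_inf_def)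
qed

text \<open>The inner sums are coefficients of the Cauchy product of Euler's series with the
  geometric series in \<open>a\<close>, whose value 1 / (1 - a) cancels the normalizing
  factor.\<close>

lemma geometric_mixture_sums:
  fixes p a :: real
  assumes p: "\<bar>p\<bar> < 1" and a: "0 < a" "a < 1"
  shows "(\<lambda>n. (1 - a) * a ^ n * (of_bool (k \<le> n) * ((- 1) ^ k * p ^ k\<^sup>2 / qpoch p p k
        * (\<Sum>i\<le>n - k. p ^ ((i choose 2) + (k + 1) * i) / qpoch p p i)))) sums w_AC k (- a) p"
proof -
  \<comment> \<open>Chosen so that \<open>x ^ i\<close> absorbs both p^((k + 1) i) and a^i.\<close>
  define x where "x = a * p ^ Suc k"
  define e where "e i = p ^ (i choose 2) / qpoch p p i" for i
  define c where "c = (- 1) ^ k * p ^ k\<^sup>2 / qpoch p p k"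
  have ex: "e i * x ^ i = p ^ ((i choose 2) + (k + 1) * i) / qpoch p p i * a ^ i" for i
    by (simp add: e_def x_def power_mult_distrib power_add mult_ac flip: power_mult)
  have S: "summable (\<lambda>i. norm (e i * x ^ i))" "(\<Sum>i. e i * x ^ i) = qpoch_inf (- x) p"
    unfolding e_def by (rule euler_qpoch_inf[OF p])+
  have geo: "summable (\<lambda>i. norm (a ^ i))" "(\<Sum>i. a ^ i) = 1 / (1 - a)"
    using a by (auto simp: suminf_geometric norm_power)
  have "(\<lambda>m. \<Sum>i\<le>m. e i * x ^ i * a ^ (m - i)) sums (qpoch_inf (- x) p * (1 / (1 - a)))"
    using Cauchy_product_sums[OF S(1) geo(1)] S(2) geo(2) by simp
  moreover have "(\<Sum>i\<le>m. e i * x ^ i * a ^ (m - i))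
      = a ^ m * (\<Sum>i\<le>m. p ^ ((i choose 2) + (k + 1) * i) / qpoch p p i)" for m
    unfolding sum_distrib_left
  proof (rule sum.cong[OF refl])
    fix i assume "i \<in> {..m}"
    then have "a ^ m = a ^ i * a ^ (m - i)" by (simp flip: power_add)
    then show "e i * x ^ i * a ^ (m - i) = a ^ m * (p ^ ((i choose 2) + (k + 1) * i) / qpoch p p i)"
      unfolding ex by (simp add: mult_ac)
  qed
  ultimately have "(\<lambda>m. a ^ m * (\<Sum>i\<le>m. p ^ ((i choose 2) + (k + 1) * i) / qpoch p p i))
      sums (qpoch_inf (- x) p * (1 / (1 - a)))" by simp
  then have "(\<lambda>m. (1 - a) * a ^ k * c * (a ^ m * (\<Sum>i\<le>m. p ^ ((i choose 2) + (k + 1) * i) / qpoch p p i)))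
      sums ((1 - a) * a ^ k * c * (qpoch_inf (- x) p * (1 / (1 - a))))"
    by (rule sums_mult)
  then have "(\<lambda>m. (1 - a) * a ^ (m + k) * (of_bool (k \<le> m + k) * (c
        * (\<Sum>i\<le>m + k - k. p ^ ((i choose 2) + (k + 1) * i) / qpoch p p i)))) sums (a ^ k * c * qpoch_inf (- x) p)"
    using a by (simp add: power_add mult_ac)
  then have sums: "(\<lambda>n. (1 - a) * a ^ n * (of_bool (k \<le> n) * (c
        * (\<Sum>i\<le>n - k. p ^ ((i choose 2) + (k + 1) * i) / qpoch p p i)))) sums (a ^ k * c * qpoch_inf (- x) p)"
    by (subst (asm) sums_iff_shift) simp
  have conv: "convergent_prod (\<lambda>r. 1 - (- a * p) * p ^ r)"
  proof (rule abs_convergent_prod_imp_convergent_prod, rule summable_imp_abs_convergent_prod)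
    have "summable (\<lambda>r. \<bar>a * p\<bar> * \<bar>p\<bar> ^ r)" using p by (intro summable_mult summable_geometric) auto
    then show "summable (\<lambda>r. norm (1 - (- a * p) * p ^ r - 1))" by (simp add: abs_mult power_abs)
  qed
  have nz: "1 - (- a * p) * p ^ r \<noteq> 0" for r
  proof -
    have "a * \<bar>p\<bar> ^ Suc r \<le> a * 1" using p a by (intro mult_left_mono power_le_one) auto
    then have "a * \<bar>p\<bar> ^ Suc r < 1" using a by linarith
    then have "\<bar>a * p ^ Suc r\<bar> < 1" using a by (simp add: abs_mult power_abs)
    then show ?thesis by auto
  qed
  \<comment> \<open>As -x = (-a p) p^k, splitting off the first k factors leaves
    \<open>qpoch_inf (- x) p\<close>; this produces the denominator
    \<open>qpoch (- a * p) p k\<close> of the weight.\<close>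
  have "qpoch_inf (- a * p) p = qpoch (- a * p) p k * qpoch_inf (- x) p"
    using prodinf_split_initial_segment[OF conv nz, of k] conv nz
    by (simp add: qpoch_inf_def qpoch_def x_def power_add mult_ac)
  moreover have "qpoch (- a * p) p k \<noteq> 0" using nz by (simp add: qpoch_def)
  ultimately have "w_AC k (- a) p = a ^ k * c * qpoch_inf (- x) p"
    by (simp add: w_AC_def c_def power_minus[of a])
  then show ?thesis using sums by (simp add: c_def)
qed

section \<open>Unitary matrices as isometries\<close>

text \<open>Vectors of length n are replaced by functions vanishing from n on: the vector space
  locale takes a single additive group type, and vectors of mixed lengths do not form a
  group.\<close>

definition scale_fun :: "'a::times \<Rightarrow> (nat \<Rightarrow> 'a) \<Rightarrow> nat \<Rightarrow> 'a" where
  "scale_fun c f = (\<lambda>i. c * f i)"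

definition coord_space :: "nat \<Rightarrow> (nat \<Rightarrow> 'a::zero) set" where
  "coord_space n = {f. \<forall>i\<ge>n. f i = 0}"

definition coords :: "'a::zero vec \<Rightarrow> nat \<Rightarrow> 'a" where
  "coords v = (\<lambda>i. if i < dim_vec v then v $ i else 0)"

lemma vec_coords: "v \<in> carrier_vec n \<Longrightarrow> vec n (coords v) = v"
  by (auto simp: coords_def)

lemma coords_vec: "f \<in> coord_space n \<Longrightarrow> coords (vec n f) = f"
  by (auto simp: coords_def coord_space_def)

lemma coords_in_coord_space: "v \<in> carrier_vec n \<Longrightarrow> coords v \<in> coord_space n"
  by (auto simp: coords_def coord_space_def)

lemma vec_add: "vec n (f + g) = vec n f + vec n g"
  by auto

lemma vec_scale_fun: "vec n (scale_fun c f) = c \<cdot>\<^sub>v vec n f"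
  by (auto simp: scale_fun_def)

lemma card_coord_space: "card (coord_space n :: (nat \<Rightarrow> 'a::{zero,finite}) set) = CARD('a) ^ n"
proof -
  have "bij_betw (\<lambda>f. restrict f {..<n}) (coord_space n) ({..<n} \<rightarrow>\<^sub>E (UNIV :: 'a set))"
  proof (rule bij_betw_byWitness[where f' = "\<lambda>f i. if i < n then f i else 0"])
    show "\<forall>f\<in>coord_space n :: (nat \<Rightarrow> 'a) set. (\<lambda>i. if i < n then restrict f {..<n} i else 0) = f"
    proof (intro ballI ext)
      fix f :: "nat \<Rightarrow> 'a" and i assume "f \<in> coord_space n"
      then show "(if i < n then restrict f {..<n} i else 0) = f i"
        by (cases "i < n") (simp_all add: coord_space_def)
    qed
    show "\<forall>f\<in>{..<n} \<rightarrow>\<^sub>E (UNIV :: 'a set). restrict (\<lambda>i. if i < n then f i else 0) {..<n} = f"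
    proof (intro ballI ext)
      fix f :: "nat \<Rightarrow> 'a" and i assume "f \<in> {..<n} \<rightarrow>\<^sub>E UNIV"
      then show "restrict (\<lambda>i. if i < n then f i else 0) {..<n} i = f i"
        by (cases "i < n") (simp_all add: PiE_def extensional_def)
    qed
    show "(\<lambda>f. restrict f {..<n}) ` (coord_space n :: (nat \<Rightarrow> 'a) set) \<subseteq> {..<n} \<rightarrow>\<^sub>E UNIV"
      by (rule image_subsetI) (rule restrict_PiE_iff[THEN iffD2], simp)
    show "(\<lambda>f i. if i < n then f i else 0) ` ({..<n} \<rightarrow>\<^sub>E (UNIV :: 'a set)) \<subseteq> coord_space n"
      by (rule image_subsetI) (simp add: coord_space_def)
  qed
  then have "card (coord_space n :: (nat \<Rightarrow> 'a) set) = card ({..<n} \<rightarrow>\<^sub>E (UNIV :: 'a set))"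
    by (rule bij_betw_same_card)
  then show ?thesis by (simp add: card_PiE)
qed

lemma vector_space_scale_fun: "vector_space (scale_fun :: 'a::field \<Rightarrow> _)"
  by unfold_locales (simp_all add: scale_fun_def fun_eq_iff algebra_simps)

lemma module_scale_fun: "Modules.module (scale_fun :: 'a::field \<Rightarrow> _)"
  by unfold_locales (simp_all add: scale_fun_def fun_eq_iff algebra_simps)

locale unitary_geometry =
  fixes q n :: nat and form :: "'a::{field,finite} vec \<Rightarrow> 'a vec \<Rightarrow> 'a"
  assumes q: "primepow q" and card: "CARD('a) = q\<^sup>2"
    and form: "nondegenerate_hermitian_form q n form"
begin

lemma form_carrier:
  assumes "u \<in> carrier_vec n" "v \<in> carrier_vec n" "w \<in> carrier_vec n"
  shows "form (u + v) w = form u w + form v w" "form (c \<cdot>\<^sub>v u) w = c * form u w"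
    "form w u = form u w ^ q"
  using form assms unfolding nondegenerate_hermitian_form_def by blast+

text \<open>\<open>vec n\<close> truncates any function to length n, so the form identities hold on
  the whole type although \<open>form\<close> is controlled only on
  \<open>carrier_vec n\<close>.\<close>

sublocale hermitian_space scale_fun q n "\<lambda>u v. form (vec n u) (vec n v)" "coord_space n"
proof (intro hermitian_space.intro hermitian_space_axioms.intro vector_space_scale_fun
    quadratic_field.intro q card)
  show "Modules.module.subspace scale_fun (coord_space n :: (nat \<Rightarrow> 'a) set)"
    unfolding Modules.module.subspace_def[OF module_scale_fun]
    by (auto simp: coord_space_def scale_fun_def)
  show "card (coord_space n :: (nat \<Rightarrow> 'a) set) = CARD('a) ^ n" by (rule card_coord_space)
  fix u v w :: "nat \<Rightarrow> 'a" and c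
  show "form (vec n (u + v)) (vec n w) = form (vec n u) (vec n w) + form (vec n v) (vec n w)"
    unfolding vec_add by (rule form_carrier) auto
  show "form (vec n (scale_fun c u)) (vec n w) = c * form (vec n u) (vec n w)"
    unfolding vec_scale_fun by (rule form_carrier(2)[where v = "vec n u"]) auto
  show "form (vec n w) (vec n u) = form (vec n u) (vec n w) ^ q"
    by (rule form_carrier(3)[where v = "vec n u"]) auto
  assume u: "u \<in> coord_space n" and "\<And>w. w \<in> coord_space n \<Longrightarrow> form (vec n u) (vec n w) = 0"
  then have "\<forall>w\<in>carrier_vec n. form (vec n u) w = 0"
    by (metis coords_in_coord_space vec_coords)
  then have "vec n u = 0\<^sub>v n"
    using form unfolding nondegenerate_hermitian_form_def by (metis vec_carrier)
  then have "coords (vec n u) = coords (0\<^sub>v n)" by simp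
  then show "u = 0" using coords_vec[OF u] by (auto simp: coords_def)
qed

definition isometry_of_mat :: "'a mat \<Rightarrow> (nat \<Rightarrow> 'a) \<Rightarrow> nat \<Rightarrow> 'a" where
  "isometry_of_mat g = (\<lambda>u\<in>coord_space n. coords (g *\<^sub>v vec n u))"

lemma vec_isometry_of_mat:
  assumes "g \<in> carrier_mat n n" "u \<in> coord_space n"
  shows "vec n (isometry_of_mat g u) = g *\<^sub>v vec n u"
  using assms by (simp add: isometry_of_mat_def vec_coords[of _ n])

lemma vec_inj: "u \<in> coord_space n \<Longrightarrow> v \<in> coord_space n \<Longrightarrow> vec n u = vec n v \<Longrightarrow> u = v"
  by (metis coords_vec)

lemma isometry_of_mat_in_isometries:
  assumes "g \<in> unitary_group n form"
  shows "isometry_of_mat g \<in> isometries"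
proof -
  have g: "g \<in> carrier_mat n n" and iso: "\<And>u v. u \<in> carrier_vec n \<Longrightarrow> v \<in> carrier_vec n
      \<Longrightarrow> form (g *\<^sub>v u) (g *\<^sub>v v) = form u v"
    using assms by (auto simp: unitary_group_def)
  have mem: "isometry_of_mat g u \<in> coord_space n" if "u \<in> coord_space n" for u
    using that g by (auto simp: isometry_of_mat_def intro!: coords_in_coord_space)
  show ?thesis
    unfolding isometries_def mem_Collect_eq
  proof (intro conjI ballI allI)
    show "isometry_of_mat g \<in> coord_space n \<rightarrow>\<^sub>E coord_space n"
      using mem by (auto simp: isometry_of_mat_def)
    fix u v :: "nat \<Rightarrow> 'a" and c
    assume u: "u \<in> coord_space n"
    show "isometry_of_mat g (scale_fun c u) = scale_fun c (isometry_of_mat g u)"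
    proof (rule vec_inj)
      show "vec n (isometry_of_mat g (scale_fun c u)) = vec n (scale_fun c (isometry_of_mat g u))"
        using g u subspace_V
        by (simp add: vec_isometry_of_mat subspace_scale vec_scale_fun mult_mat_vec[OF g])
    qed (use u mem subspace_V in \<open>auto intro!: subspace_scale\<close>)
    assume v: "v \<in> coord_space n"
    show "isometry_of_mat g (u + v) = isometry_of_mat g u + isometry_of_mat g v"
    proof (rule vec_inj)
      show "vec n (isometry_of_mat g (u + v)) = vec n (isometry_of_mat g u + isometry_of_mat g v)"
        using g u v subspace_V
        by (simp add: vec_isometry_of_mat subspace_add vec_add mult_add_distrib_mat_vec[OF g])
    qed (use u v mem subspace_V in \<open>auto intro!: subspace_add\<close>)
    show "form (vec n (isometry_of_mat g u)) (vec n (isometry_of_mat g v)) = form (vec n u) (vec n v)"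
      using g u v iso by (simp add: vec_isometry_of_mat)
  qed
qed

lemma mat_eqI_mult_vec:
  fixes A B :: "'a mat"
  assumes A: "A \<in> carrier_mat n n" and B: "B \<in> carrier_mat n n"
    and eq: "\<And>v. v \<in> carrier_vec n \<Longrightarrow> A *\<^sub>v v = B *\<^sub>v v"
  shows "A = B"
proof (rule eq_matI)
  fix i j assume ij: "i < dim_row B" "j < dim_col B"
  have "(A *\<^sub>v unit_vec n j) $ i = (B *\<^sub>v unit_vec n j) $ i" using eq by simp
  then show "A $$ (i, j) = B $$ (i, j)" using A B ij by simp
qed (use A B in auto)

lemma isometry_of_mat_inj: "inj_on isometry_of_mat (unitary_group n form)"
proof (rule inj_onI)
  fix f g assume fg: "f \<in> unitary_group n form" "g \<in> unitary_group n form"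
    and eq: "isometry_of_mat f = isometry_of_mat g"
  have fc: "f \<in> carrier_mat n n" and gc: "g \<in> carrier_mat n n" using fg by (auto simp: unitary_group_def)
  show "f = g"
  proof (rule mat_eqI_mult_vec[OF fc gc])
    fix v :: "'a vec" assume v: "v \<in> carrier_vec n"
    then show "f *\<^sub>v v = g *\<^sub>v v"
      using vec_isometry_of_mat[OF fc coords_in_coord_space[OF v]]
        vec_isometry_of_mat[OF gc coords_in_coord_space[OF v]] eq by (simp add: vec_coords)
  qed
qed

lemma isometry_expand:
  assumes f: "f \<in> isometries" and J: "J \<subseteq> {..<n}"
  shows "f (\<lambda>i. if i \<in> J then u i else 0) k = (\<Sum>j\<in>J. u j * f (coords (unit_vec n j)) k)"
proof -
  have "finite J" using J finite_subset by blast
  then show ?thesis using J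
  proof (induction J)
    case empty
    have "f (scale_fun 0 0) = scale_fun 0 (f 0)"
      using isometriesD(3)[OF f, of 0] subspace_0[OF subspace_V] by blast
    then show ?case by (simp add: scale_fun_def zero_fun_def fun_eq_iff)
  next
    case (insert j J)
    let ?v = "\<lambda>i. if i \<in> J then u i else 0" and ?e = "coords (unit_vec n j)"
    have e: "?e \<in> coord_space n" by (intro coords_in_coord_space) simp
    have v: "?v \<in> coord_space n" using insert.prems by (auto simp: coord_space_def)
    have "(\<lambda>i. if i \<in> insert j J then u i else 0) = ?v + scale_fun (u j) ?e"
      using insert by (auto simp: fun_eq_iff scale_fun_def coords_def)
    then have "f (\<lambda>i. if i \<in> insert j J then u i else 0) = f ?v + scale_fun (u j) (f ?e)"
      using isometriesD(2)[OF f v] isometriesD(3)[OF f e] subspace_scale[OF subspace_V e] by simp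
    then show ?case using insert by (simp add: scale_fun_def add.commute)
  qed
qed

lemma isometry_of_mat_surj:
  assumes f: "f \<in> isometries"
  shows "f \<in> isometry_of_mat ` unitary_group n form"
proof -
  define g where "g = mat n n (\<lambda>(i, j). f (coords (unit_vec n j)) i)"
  have g: "g \<in> carrier_mat n n" by (simp add: g_def)
  have gv: "g *\<^sub>v vec n u = vec n (f u)" if u: "u \<in> coord_space n" for u
  proof (rule eq_vecI)
    fix i assume i: "i < dim_vec (vec n (f u))"
    have "(\<lambda>i. if i \<in> {..<n} then u i else 0) = u" using u by (auto simp: coord_space_def fun_eq_iff)
    then have "f u i = (\<Sum>j<n. u j * f (coords (unit_vec n j)) i)"
      using isometry_expand[OF f subset_refl, of u i] by simp
    then show "(g *\<^sub>v vec n u) $ i = vec n (f u) $ i"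
      using i by (simp add: g_def scalar_prod_def lessThan_atLeast0 mult.commute)
  qed (simp add: g_def)
  have gv': "g *\<^sub>v v = vec n (f (coords v))" if "v \<in> carrier_vec n" for v
    using gv[OF coords_in_coord_space[OF that]] vec_coords[OF that] by simp
  have iso: "form (g *\<^sub>v u) (g *\<^sub>v v) = form u v" if "u \<in> carrier_vec n" "v \<in> carrier_vec n" for u v
    using isometriesD(4)[OF f coords_in_coord_space[OF that(1)] coords_in_coord_space[OF that(2)]]
    by (simp add: gv' that vec_coords)
  \<comment> \<open>Nondegeneracy makes \<open>f\<close> injective, so \<open>g\<close> kills no
    nonzero vector; this supplies the invertibility demanded by
    \<open>unitary_group\<close>.\<close>
  have "det g \<noteq> 0"
  proof
    assume "det g = 0"
    then obtain v where v: "v \<in> carrier_vec n" "v \<noteq> 0\<^sub>v n" "g *\<^sub>v v = 0\<^sub>v n"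
      using det_0_iff_vec_prod_zero_field[OF g] by blast
    let ?u = "coords v"
    have u: "?u \<in> coord_space n" using v by (intro coords_in_coord_space)
    have f0: "f 0 = 0"
      using isometriesD(2)[OF f, of 0 0] subspace_0[OF subspace_V] by simp
    have "vec n (f ?u) = vec n 0" using v gv'[OF v(1)] by auto
    then have "f ?u = 0"
      using vec_inj[of "f ?u" 0] isometriesD(1)[OF f u] subspace_0[OF subspace_V] by simp
    then have "?u = 0"
      using inj_onD[OF isometry_inj[OF f], of ?u 0] f0 u subspace_0[OF subspace_V] by simp
    then have "v = vec n 0" using vec_coords[OF v(1)] by simp
    then show False using v(2) by auto
  qed
  then have "g \<in> Units (ring_mat TYPE('a) n ())" by (rule det_non_zero_imp_unit[OF g])
  then have "invertible_mat g"
    using g by (auto simp: Units_def ring_mat_def invertible_mat_def inverts_mat_def square_mat.simps)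
  then have "g \<in> unitary_group n form" using g iso by (auto simp: unitary_group_def)
  moreover have "f = isometry_of_mat g"
  proof (rule extensionalityI[OF isometriesD(5)[OF f]])
    fix u :: "nat \<Rightarrow> 'a" assume u: "u \<in> coord_space n"
    show "f u = isometry_of_mat g u"
      using u gv[OF u] coords_vec[OF isometriesD(1)[OF f u]] by (simp add: isometry_of_mat_def)
  qed (auto simp: isometry_of_mat_def)
  ultimately show ?thesis by blast
qed

lemma bij_betw_isometry_of_mat: "bij_betw isometry_of_mat (unitary_group n form) isometries"
  unfolding bij_betw_def
  using isometry_of_mat_inj isometry_of_mat_in_isometries isometry_of_mat_surj by blast

lemma card_fixed_vectors:
  assumes "g \<in> unitary_group n form"
  shows "card (fixed_vectors g) = card {v \<in> coord_space n. isometry_of_mat g v = v}"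
proof -
  have g: "g \<in> carrier_mat n n" using assms by (simp add: unitary_group_def)
  have "bij_betw coords (fixed_vectors g) {v \<in> coord_space n. isometry_of_mat g v = v}"
  proof (rule bij_betw_byWitness[of _ "vec n"])
    show "vec n ` {v \<in> coord_space n. isometry_of_mat g v = v} \<subseteq> fixed_vectors g"
      using g vec_isometry_of_mat[OF g] by (auto simp: fixed_vectors_def) metis
  qed (use g in \<open>auto simp: fixed_vectors_def vec_coords coords_vec coords_in_coord_space isometry_of_mat_def\<close>)
  then show ?thesis by (rule bij_betw_same_card)
qed

lemma prob_fixed_vectors:
  assumes p: "p = - 1 / real q"
  shows "measure_pmf.prob (pmf_of_set (unitary_group n form)) {g. card (fixed_vectors g) = q ^ (2 * k)}
    = of_bool (k \<le> n) * ((- 1) ^ k * p ^ k\<^sup>2 / qpoch p p k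
        * (\<Sum>i\<le>n - k. p ^ ((i choose 2) + (k + 1) * i) / qpoch p p i))"
proof -
  let ?U = "unitary_group n form" and ?S = "{g. card (fixed_vectors g) = q ^ (2 * k)}"
  have ne: "?U \<noteq> {}" "finite ?U" using one_in_unitary_group[of n form] finite_unitary_group by blast+
  have "card (?U \<inter> ?S) = card {f \<in> isometries. card {v \<in> coord_space n. f v = v} = CARD('a) ^ k}"
  proof (rule bij_betw_same_card[of isometry_of_mat])
    have "isometry_of_mat ` (?U \<inter> ?S) = {f \<in> isometries. card {v \<in> coord_space n. f v = v} = CARD('a) ^ k}"
      using card_fixed_vectors isometry_of_mat_in_isometries isometry_of_mat_surj
      by (fastforce simp: card power_mult)
    moreover have "inj_on isometry_of_mat (?U \<inter> ?S)"
      using isometry_of_mat_inj by (rule inj_on_subset) auto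
    ultimately show "bij_betw isometry_of_mat (?U \<inter> ?S)
        {f \<in> isometries. card {v \<in> coord_space n. f v = v} = CARD('a) ^ k}"
      by (simp add: bij_betw_def)
  qed
  moreover have "card ?U = card isometries" by (rule bij_betw_same_card[OF bij_betw_isometry_of_mat])
  moreover have "card isometries \<noteq> 0" using identity_in_isometries by auto
  ultimately show ?thesis
    using card_isometries_fixed_space[OF p, of k] by (simp add: measure_pmf_of_set[OF ne])
qed

end

text \<open>The mixture is evaluated as a series in \<open>ennreal\<close>; nonnegative terms make
  \<open>w\<close> nonnegative, so the equality descends to the reals.\<close>

lemma prob_bind_pmf_nat_sums:
  fixes N :: "nat pmf"
  assumes "(\<lambda>n. pmf N n * measure_pmf.prob (K n) S) sums w"
  shows "measure_pmf.prob (bind_pmf N K) S = w"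
proof -
  have "ennreal (measure_pmf.prob (bind_pmf N K) S) = (\<Sum>n. ennreal (pmf N n * measure_pmf.prob (K n) S))"
    by (simp add: measure_pmf.emeasure_eq_measure[symmetric] nn_integral_measure_pmf
        nn_integral_count_space_nat ennreal_mult)
  also have "\<dots> = ennreal w"
    by (rule suminf_ennreal_eq[OF _ assms]) simp
  finally show ?thesis
    using sums_le[OF _ sums_zero assms] by (simp add: measure_nonneg)
qed

theorem theorem5p8:
  fixes q k :: nat and a p :: real
    and h :: "nat \<Rightarrow> 'a::{field,finite} vec \<Rightarrow> 'a vec \<Rightarrow> 'a"
  assumes q: "primepow q"
    and card_field: "CARD('a) = q\<^sup>2"
    and a: "0 < a" "a < 1"
    and form: "\<And>n. nondegenerate_hermitian_form q n (h n)"
    and p: "p = - 1 / real q"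
  shows "measure_pmf.prob (random_unitary a h) {g. card (fixed_vectors g) = q ^ (2 * k)}
           = w_AC k (- a) p"
  unfolding random_unitary_def
proof (rule prob_bind_pmf_nat_sums)
  have "q > 1" using primepow_gt_Suc_0[OF q] by simp
  then have p1: "\<bar>p\<bar> < 1" by (simp add: p)
  have "measure_pmf.prob (pmf_of_set (unitary_group n (h n))) {g. card (fixed_vectors g) = q ^ (2 * k)}
    = of_bool (k \<le> n) * ((- 1) ^ k * p ^ k\<^sup>2 / qpoch p p k
        * (\<Sum>i\<le>n - k. p ^ ((i choose 2) + (k + 1) * i) / qpoch p p i))" for n
  proof -
    interpret unitary_geometry q n "h n" by unfold_locales (fact q card_field form)+
    show ?thesis by (rule prob_fixed_vectors[OF p])
  qed
  then show "(\<lambda>n. pmf (geometric_pmf (1 - a)) n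
      * measure_pmf.prob (pmf_of_set (unitary_group n (h n))) {g. card (fixed_vectors g) = q ^ (2 * k)})
    sums w_AC k (- a) p"
    using geometric_mixture_sums[OF p1 a, of k] a by (simp add: mult.commute[of _ "1 - a"])
qed

end
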